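(* Let $x\in[0,1)$, $x=[0;a_1,a_2,\dots]$, and for $n\in\mathbb N$ let $t_n=T^n(x)=[0;a_{n+1},a_{n+2},\dots]$ and $v_n=\frac{q_{n-1}}{q_n}=[0;a_n,a_{n-1},\dots,a_1]$. Furthermore, assuming that $a_{n+1}=1=a_n$, we have the following cases, where $\ell\in\mathbb N$ and $1\le h\le n$. (i) Let $t_n\neq g$, $t_n=[0;1^{\ell},a_{n+\ell+1},\dots]$ with $a_{n+\ell+1}\neq 1$, and let $v_n=[0;1^h,a_{n-h},\dots,a_1]$ with $a_{n-h}\neq 1$ if $1\le h<n$, and $v_n=[0;1^h]$ if $h=n$. Then $$\min\{\Theta_{n-1}(x),\Theta_n(x),\Theta_{n+1}(x)\}\le B_{\ell,h}<\frac1{\sqrt5},$$ where the Borel-constant $B_{\ell,h}$ is given by - if $\ell=h$ is odd: $B_{\ell,h}=\dfrac{c_\ell}{1+c_{\ell-2}c_\ell}$; - if $\ell,h$ are odd and $h=\ell-2$: $B_{\ell,h}=\dfrac{c_\ell(1-c_\ell)}{2c_\ell^2-2c_\ell+1}$; - if $\ell,h$ are odd and $h<\ell-2$: $B_{\ell,h}=\dfrac{c_{\ell-2}}{1+c_{\ell-2}c_h}$; - if $\ell,h$ are odd and $h>\ell$: $B_{\ell,h}=\dfrac{(1-c_\ell)(1+c_{h-2})}{1+c_\ell c_{h-2}}$; - if $\ell$ is odd, $h$ is even and $h\ge\ell+1$: $B_{\ell,h}=\dfrac{(1-c_\ell)(1+c_h)}{1+c_\ell c_h}$; - if $\ell$ is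 odd, $h$ is even and $h\le\ell-1$: $B_{\ell,h}=\dfrac{c_h}{1+c_\ell c_h}$; - if $\ell$ is even and $h$ is odd: $B_{\ell,h}=\dfrac{c_\ell}{1+c_\ell c_h}$; - if $\ell=h$ is even: $B_{\ell,h}=\dfrac{c_\ell}{1+c_\ell^2}$; - if $\ell,h$ are even and $h\ge\ell+2$: $B_{\ell,h}=\dfrac{c_\ell}{1+c_{h-2}c_\ell}$; - if $\ell,h$ are even and $h\le\ell-2$: $B_{\ell,h}=\dfrac{c_h}{1+c_{\ell-2}c_h}$. The Borel-constants $B_{\ell,h}$ are always best possible, i.e., they cannot be replaced by a smaller constant. (ii) Let $t_n=g$ for some $n\in\mathbb N\cup\{0\}$. Then we have the following cases. (iia) Let $n\ge1$, $a_n\ge2$. Then $$\min\{\Theta_{n-1},\Theta_n,\Theta_{n+1}\}=\Theta_{n-1}<g^2<\Theta_{n+1}<\tfrac1{\sqrt5}<\Theta_n .$$ (iib) Let $n\ge1$ and $1\le\ell<n$ be such that $v_n=[0;1^\ell,a_{n-\ell},\dots,a_1]$ with $a_{n-\ell}\neq1$. Then $$\min\{\Theta_{n-1},\Theta_n,\Theta_{n+1}\}=\begin{cases}\Theta_n\le\dfrac{g}{1+g\,c_\ell}<\dfrac1{\sqrt5}<\Theta_{n+1}<\Theta_{n-1},&\text{if }\ell\text{ is odd},\\[2mm] \Theta_{n-1}\le\dfrac{c_\ell}{1+g\,c_\ell}<\Theta_{n+1}<\dfrac1{\sqrt5}<\Theta_n,&\text{if }\ell\text{ is even}.\end{cases}$$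 (iic) Let $n=0$, so $x=g=t_0=[0;\overline1]$ and $v_0=0$; moreover, $t_m=g$ and $v_m=[0;1^m]$ for all $m\in\mathbb N$. Then for $m\in\mathbb N$, $$\min\{\Theta_{m-1},\Theta_m,\Theta_{m+1}\}=\begin{cases}\Theta_m=\dfrac{g}{1+g\,c_{m-2}}<\dfrac1{\sqrt5}<\Theta_{m+1}<\Theta_{m-1},&\text{if }m\text{ is odd},\\[2mm] \Theta_{m-1}=\dfrac{g}{1+g\,c_{m-3}}<\Theta_{m+1}<\dfrac1{\sqrt5}<\Theta_m,&\text{if }m\text{ is even}.\end{cases}$$
   Context: Here $\mathbb N=\{1,2,\dots\}$ and $g=\frac{\sqrt5-1}{2}$. For $x\in[0,1)$, $[0;a_1,a_2,\dots]$ denotes the regular continued fraction expansion $x=1/(a_1+1/(a_2+\cdots))$ with digits $a_i\in\mathbb N$, and $T$ is the Gauss map, $T(0)=0$ and $T(x)=1/x-\lfloor1/x\rfloor$ for $x\in(0,1)$. The convergents are $p_n/q_n=[0;a_1,\dots,a_n]$ in lowest terms with $q_n>0$ (and $p_0/q_0=0/1$). The approximation coefficients are $\Theta_n=\Theta_n(x)=q_n^2\left|x-\frac{p_n}{q_n}\right|$. Also $t_0=x$ and $v_0=0$. Inside a continued fraction, $1^{\ell}$ means $\ell$ consecutive digits equal to $1$, and a bar indicates the period. Fibonacci numbers are defined by $F_{-1}=0$, $F_0=1$, $F_n=F_{n-1}+F_{n-2}$ for $n\ge1$. For $m\ge-1$, $c_m=F_{m+1}/F_{m+2}=[0;1^{m+2}]$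 (so $c_{-1}=1$, $c_0=\tfrac12$, $c_1=\tfrac23$, $c_2=\tfrac35$, ...).
   Formalization: In (iia) the strict inequality Θ_{n-1} < g² fails when n = 1 and a_1 = 2 (that is, x = g², where Θ_0 = g²); there it is replaced by equality Θ_0 = g², the rest of the chain being unchanged. *)

theory Defs
  imports Complex_Main "HOL-Number_Theory.Fib"
begin

definition golden :: real where
  "golden = (sqrt 5 - 1) / 2"

definition gauss_map :: "real \<Rightarrow> real" where
  "gauss_map x = (if x = 0 then 0 else 1 / x - of_int \<lfloor>1 / x\<rfloor>)"

(* The future t_n = T^n(x) = [0; a_{n+1}, a_{n+2}, ...] of x at time n. *)
definition cf_t :: "real \<Rightarrow> nat \<Rightarrow> real" where
  "cf_t x n = (gauss_map ^^ n) x"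

(* The digit a_i of x = [0; a_1, a_2, ...], for i >= 1. A genuine digit is at least 1; if x is
   rational, cf_digit x i = 0 for all indices i beyond the end of its (finite) expansion.
   Since the orbit of x stays in [0,1), a finite expansion never ends with the digit 1, so a
   digit following a digit 1 is always genuine. The index 0 is not used. *)
definition cf_digit :: "real \<Rightarrow> nat \<Rightarrow> nat" where
  "cf_digit x i = nat \<lfloor>1 / cf_t x (i - 1)\<rfloor>"

(* [a_1, ..., a_n] *)
definition cf_digits :: "real \<Rightarrow> nat \<Rightarrow> nat list" where
  "cf_digits x n = map (cf_digit x) [1..<Suc n]"

(* The value of the finite continued fraction [0; d_1, ..., d_k]. *)
fun cf_value :: "nat list \<Rightarrow> 'a::field" where
  "cf_value [] = 0"
| "cf_value (d # ds) = 1 / (of_nat d + cf_value ds)"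

(* quotient_of yields the lowest-terms representation with positive denominator. *)
definition conv_num :: "real \<Rightarrow> nat \<Rightarrow> int" where
  "conv_num x n = fst (quotient_of (cf_value (cf_digits x n)))"

definition conv_den :: "real \<Rightarrow> nat \<Rightarrow> int" where
  "conv_den x n = snd (quotient_of (cf_value (cf_digits x n)))"

definition theta :: "real \<Rightarrow> nat \<Rightarrow> real" where
  "theta x n = (of_int (conv_den x n))\<^sup>2 * \<bar>x - of_int (conv_num x n) / of_int (conv_den x n)\<bar>"

definition cf_v :: "real \<Rightarrow> nat \<Rightarrow> real" where
  "cf_v x n = (if n = 0 then 0 else of_int (conv_den x (n - 1)) / of_int (conv_den x n))"

(* Fibonacci numbers shifted so that F_{-1} = 0 and F_0 = 1. *)
definition fib_F :: "int \<Rightarrow> nat" where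
  "fib_F m = fib (nat (m + 1))"

(* Used for m >= -1 only. *)
definition cf_c :: "int \<Rightarrow> real" where
  "cf_c m = of_nat (fib_F (m + 1)) / of_nat (fib_F (m + 2))"

(* v_n = [0; 1^h, a_{n-h}, ..., a_1] with a_{n-h} different from 1; for h = n this is
   v_n = [0; 1^h]. *)
definition past_ones :: "real \<Rightarrow> nat \<Rightarrow> nat \<Rightarrow> bool" where
  "past_ones x n h \<longleftrightarrow>
     1 \<le> h \<and> h \<le> n \<and>
     cf_v x n = cf_value (replicate h 1 @ rev (cf_digits x (n - h))) \<and>
     (h < n \<longrightarrow> cf_digit x (n - h) \<noteq> 1)"

(* t_n = [0; 1^l, a_{n+l+1}, ...] with a_{n+l+1} different from 1. *)
definition future_ones :: "real \<Rightarrow> nat \<Rightarrow> nat \<Rightarrow> bool" where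
  "future_ones x n l \<longleftrightarrow>
     1 \<le> l \<and>
     cf_digits (cf_t x n) l = replicate l 1 \<and>
     cf_digit x (n + l + 1) \<noteq> 1"

(* The Borel constant B_{l,h}, for l, h >= 1. *)
definition borel_const :: "nat \<Rightarrow> nat \<Rightarrow> real" where
  "borel_const l h =
    (let cl = cf_c (int l); cl2 = cf_c (int l - 2); ch = cf_c (int h); ch2 = cf_c (int h - 2) in
     if odd l \<and> odd h then
       (if h = l then cl / (1 + cl2 * cl)
        else if h + 2 = l then cl * (1 - cl) / (2 * cl\<^sup>2 - 2 * cl + 1)
        else if h + 2 < l then cl2 / (1 + cl2 * ch)
        else (1 - cl) * (1 + ch2) / (1 + cl * ch2))
     else if odd l \<and> even h then
       (if h \<ge> l + 1 then (1 - cl) * (1 + ch) / (1 + cl * ch)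
        else ch / (1 + cl * ch))
     else if even l \<and> odd h then cl / (1 + cl * ch)
     else
       (if h = l then cl / (1 + cl\<^sup>2)
        else if h \<ge> l + 2 then cl / (1 + ch2 * cl)
        else ch / (1 + cl2 * ch)))"

definition min_theta :: "real \<Rightarrow> nat \<Rightarrow> real" where
  "min_theta x n = Min {theta x (n - 1), theta x n, theta x (n + 1)}"

(* The standing assumptions under which B_{l,h} bounds min_theta. *)
definition borel_case :: "real \<Rightarrow> nat \<Rightarrow> nat \<Rightarrow> nat \<Rightarrow> bool" where
  "borel_case x n l h \<longleftrightarrow>
     0 \<le> x \<and> x < 1 \<and> 1 \<le> n \<and> cf_digit x n = 1 \<and> cf_digit x (n + 1) = 1 \<and>
     cf_t x n \<noteq> golden \<and> future_ones x n l \<and> past_ones x n h"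

end

theory Submission
  imports Defs
begin

text \<open>
Write \<open>t = t\<^sub>n\<close> for the future and \<open>v = v\<^sub>n\<close> for the past. The error of the convergent satisfies
\<open>\<bar>q\<^sub>n x - p\<^sub>n\<bar> = t\<^sub>0 \<dots> t\<^sub>n\<close>, and \<open>q\<^sub>n + t\<^sub>n q\<^sub>n\<^sub>-\<^sub>1\<close> is the inverse of \<open>t\<^sub>0 \<dots> t\<^sub>n\<^sub>-\<^sub>1\<close>. These two identities
(\<open>convergent_error\<close>, \<open>inverse_prod_cf_t\<close>) give \<open>\<Theta>\<^sub>n = t / (1 + t v)\<close> and, shifting by one step in
either direction, \<open>\<Theta>\<^sub>n\<^sub>-\<^sub>1 = v / (1 + t v)\<close> and, if the digit \<open>a\<^sub>n\<^sub>+\<^sub>1\<close> is \<open>1\<close>,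
\<open>\<Theta>\<^sub>n\<^sub>+\<^sub>1 = (1 - t) (1 + v) / (1 + t v)\<close>. Each of the three is monotone in \<open>t\<close> and in \<open>v\<close>, and all three equal
\<open>1 / sqrt 5\<close> at \<open>t = v = golden\<close>; everything is thereby reduced to the geometry of the minimum of
three explicit functions, \<open>borel_min t v\<close>.

A future beginning with exactly \<open>l\<close> ones is \<open>[0; 1\<^sup>l + s]\<close> with \<open>0 < s \<le> 1 / 2\<close>, hence lies between
\<open>c\<^sub>l\<^sub>-\<^sub>2\<close> (excluded) and \<open>c\<^sub>l\<close>; the past likewise lies between \<open>c\<^sub>h\<^sub>-\<^sub>2\<close> and \<open>c\<^sub>h\<close>, both included. So \<open>(t, v)\<close>
ranges over a rectangle, situated relative to \<open>(golden, golden)\<close> according to the parities of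
\<open>l\<close> and \<open>h\<close>. The Borel constant is the value of \<open>borel_min\<close> at a suitable corner of this rectangle
(\<open>borel_const_corner\<close>) and also its maximum over the closed rectangle (\<open>borel_min_le_borel_const\<close>). It is
below \<open>1 / sqrt 5\<close> because \<open>borel_min t v < 1 / sqrt 5\<close> on the unit square wherever \<open>t \<noteq> golden\<close> (\<open>borel_min_less\<close>), and it is
optimal because every corner is attained, or is approached by letting \<open>s\<close> tend to \<open>0\<close>, by numbers
with a prescribed expansion (\<open>borel_case_attained\<close>).

For \<open>t = golden\<close> only \<open>v\<close> varies, and the order of the three coefficients and of \<open>1 / sqrt 5\<close> changes
only at \<open>v = golden\<close>; so the remaining cases depend on which side of \<open>golden\<close> the past lies.
\<close>

section \<open>Numerators and denominators of finite continued fractions\<close>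

fun cf_num :: "nat list \<Rightarrow> nat" and cf_den :: "nat list \<Rightarrow> nat" where
  "cf_num [] = 0"
| "cf_num (d # ds) = cf_den ds"
| "cf_den [] = 1"
| "cf_den (d # ds) = d * cf_den ds + cf_num ds"

lemma cf_den_pos: "\<forall>d\<in>set ds. 1 \<le> d \<Longrightarrow> 0 < cf_den ds"
  by (induction ds) auto

lemma coprime_cf_num_cf_den: "coprime (cf_num ds) (cf_den ds)"
proof (induction ds)
  case (Cons d ds)
  then show ?case
    by (simp add: coprime_iff_gcd_eq_1 gcd.commute gcd_add_mult)
qed simp

lemma cf_value_eq_cf_num_div_cf_den:
  assumes "\<forall>d\<in>set ds. 1 \<le> d"
  shows "(cf_value ds :: 'a::field_char_0) = of_nat (cf_num ds) / of_nat (cf_den ds)"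
  using assms
proof (induction ds)
  case (Cons d ds)
  have "0 < cf_den ds" "0 < cf_den (d # ds)" using Cons.prems cf_den_pos[of ds] cf_den_pos[of "d # ds"] by auto
  then have nz: "(of_nat (cf_den ds) :: 'a) \<noteq> 0" "(of_nat (cf_den (d # ds)) :: 'a) \<noteq> 0"
    by (simp_all only: of_nat_eq_0_iff)
  have "(of_nat d + cf_value ds :: 'a) = of_nat (cf_den (d # ds)) / of_nat (cf_den ds)"
    using Cons nz by (simp add: field_simps)
  then show ?case using nz by simp
qed simp

text \<open>The definitions recurse at the front of the list, the classical recurrences
\<open>p\<^sub>n = a\<^sub>n p\<^sub>n\<^sub>-\<^sub>1 + p\<^sub>n\<^sub>-\<^sub>2\<close> and
\<open>q\<^sub>n = a\<^sub>n q\<^sub>n\<^sub>-\<^sub>1 + q\<^sub>n\<^sub>-\<^sub>2\<close> at its back. They have to be proved together, since either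
function calls the other on the tail.\<close>

lemma cf_snoc:
  shows cf_num_snoc: "cf_num (ds @ [e, d]) = d * cf_num (ds @ [e]) + cf_num ds"
    and cf_den_snoc: "cf_den (ds @ [e, d]) = d * cf_den (ds @ [e]) + cf_den ds"
  by (induction ds) (auto simp: algebra_simps)

text \<open>Dividing the recurrence for the denominators by its middle term shows that
\<open>q\<^sub>n / q\<^sub>n\<^sub>-\<^sub>1\<close> is \<open>a\<^sub>n\<close> plus the inverse of the previous ratio, so the ratios unfold into the
reversed list of digits.\<close>

lemma cf_den_ratio_eq_cf_value_rev:
  assumes "\<forall>d\<in>set ds. 1 \<le> d" "1 \<le> d"
  shows "real (cf_den ds) / real (cf_den (ds @ [d])) = cf_value (d # rev ds)"
  using assms
proof (induction ds arbitrary: d rule: rev_induct)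
  case (snoc e ds)
  have pos: "0 < cf_den ds" "0 < cf_den (ds @ [e])"
    using snoc.prems cf_den_pos[of ds] cf_den_pos[of "ds @ [e]"] by auto
  have "real (cf_den ds) / real (cf_den (ds @ [e])) = cf_value (e # rev ds)"
    using snoc by simp
  then have "real d + cf_value (e # rev ds)
      = real (cf_den (ds @ [e, d])) / real (cf_den (ds @ [e]))"
    using pos unfolding cf_den_snoc by (simp add: field_simps)
  then show ?case by simp
qed simp

lemma quotient_of_cf_value:
  assumes "\<forall>d\<in>set ds. 1 \<le> d"
  shows "quotient_of (cf_value ds) = (int (cf_num ds), int (cf_den ds))"
proof -
  have "cf_value ds = Rat.Fract (int (cf_num ds)) (int (cf_den ds))"
    using cf_value_eq_cf_num_div_cf_den[OF assms, where ?'a=rat]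
    by (simp add: Fract_of_int_quotient)
  moreover have "Rat.normalize (int (cf_num ds), int (cf_den ds)) = (int (cf_num ds), int (cf_den ds))"
    using cf_den_pos[OF assms] coprime_cf_num_cf_den[of ds]
    by (intro normalize_stable) auto
  ultimately show ?thesis by (simp add: quotient_of_Fract)
qed

section \<open>Digits, future and past along an orbit of the Gauss map\<close>

lemma gauss_map_range: "0 \<le> gauss_map x" "gauss_map x < 1"
  unfolding gauss_map_def by (auto, linarith+)

lemma cf_t_range:
  assumes "0 \<le> x" "x < 1"
  shows "0 \<le> cf_t x n" "cf_t x n < 1"
  using assms gauss_map_range by (cases n; simp add: cf_t_def)+

lemma cf_t_0 [simp]: "cf_t x 0 = x"
  by (simp add: cf_t_def)

lemma cf_t_Suc: "cf_t x (Suc n) = gauss_map (cf_t x n)"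
  by (simp add: cf_t_def)

lemma cf_t_add: "cf_t (cf_t x n) i = cf_t x (n + i)"
  by (simp add: cf_t_def funpow_add[symmetric] add.commute flip: comp_apply[of "gauss_map ^^ i"])

lemma cf_digit_shift: "1 \<le> i \<Longrightarrow> cf_digit (cf_t x n) i = cf_digit x (n + i)"
  by (simp add: cf_digit_def cf_t_add)

lemma cf_t_step:
  assumes "0 \<le> x" "x < 1" "cf_t x n \<noteq> 0"
  shows "1 \<le> cf_digit x (Suc n)" "1 / cf_t x n = real (cf_digit x (Suc n)) + cf_t x (Suc n)"
proof -
  have "1 \<le> 1 / cf_t x n" using cf_t_range[OF assms(1,2), of n] assms(3) by simp
  then have "1 \<le> \<lfloor>1 / cf_t x n\<rfloor>" by linarith
  then have "1 \<le> cf_digit x (Suc n)" "real (cf_digit x (Suc n)) = of_int \<lfloor>1 / cf_t x n\<rfloor>"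
    unfolding cf_digit_def diff_Suc_1 by linarith+
  then show "1 \<le> cf_digit x (Suc n)" "1 / cf_t x n = real (cf_digit x (Suc n)) + cf_t x (Suc n)"
    using assms(3) by (simp_all add: cf_t_Suc gauss_map_def)
qed

lemma cf_t_nonzero_of_cf_digit: "cf_digit x (Suc n) \<noteq> 0 \<Longrightarrow> cf_t x n \<noteq> 0"
  by (auto simp: cf_digit_def)

lemma cf_t_nonzero_antimono:
  assumes "cf_t x n \<noteq> 0" "i \<le> n"
  shows "cf_t x i \<noteq> 0"
  using assms(2,1) by (induction rule: inc_induct) (auto simp: cf_t_Suc gauss_map_def)

lemma cf_digits_Suc: "cf_digits x (Suc n) = cf_digits x n @ [cf_digit x (Suc n)]"
  by (simp add: cf_digits_def)

lemma cf_digits_0 [simp]: "cf_digits x 0 = []"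
  by (simp add: cf_digits_def)

lemma length_cf_digits [simp]: "length (cf_digits x n) = n"
  by (simp add: cf_digits_def)

lemma cf_digits_Suc_front: "cf_digits x (Suc n) = cf_digit x 1 # cf_digits (cf_t x 1) n"
  by (induction n) (simp_all add: cf_digits_Suc cf_digit_shift)

text \<open>For rational \<open>x\<close> the orbit reaches \<open>0\<close> and the digits vanish from then on. The hypothesis
that \<open>cf_t x i\<close> is nonzero for all \<open>i < n\<close>, here and below, says that the first \<open>n\<close> digits
belong to the expansion; it still allows \<open>cf_t x n = 0\<close>.\<close>

lemma cf_digits_ge_1:
  assumes "0 \<le> x" "x < 1" "\<forall>i<n. cf_t x i \<noteq> 0"
  shows "\<forall>d\<in>set (cf_digits x n). 1 \<le> d"
  using assms(3)
proof (induction n)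
  case (Suc n)
  then show ?case using cf_t_step(1)[OF assms(1,2), of n] by (auto simp: cf_digits_Suc)
qed simp

lemma conv_eq:
  assumes "0 \<le> x" "x < 1" "\<forall>i<n. cf_t x i \<noteq> 0"
  shows "conv_num x n = int (cf_num (cf_digits x n))" "conv_den x n = int (cf_den (cf_digits x n))"
  by (simp_all add: conv_num_def conv_den_def quotient_of_cf_value[OF cf_digits_ge_1[OF assms]])

lemma cf_v_Suc_eq_cf_value:
  assumes "0 \<le> x" "x < 1" "\<forall>i<Suc n. cf_t x i \<noteq> 0"
  shows "cf_v x (Suc n) = cf_value (rev (cf_digits x (Suc n)))"
  using cf_den_ratio_eq_cf_value_rev[of "cf_digits x n" "cf_digit x (Suc n)"]
    cf_digits_ge_1[OF assms] assms
  by (simp add: cf_v_def conv_eq cf_digits_Suc)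

lemma cf_v_eq_cf_value:
  assumes "0 \<le> x" "x < 1" "\<forall>i<n. cf_t x i \<noteq> 0"
  shows "cf_v x n = cf_value (rev (cf_digits x n))"
  using cf_v_Suc_eq_cf_value[OF assms(1,2)] assms(3) by (cases n) (auto simp: cf_v_def)

lemma cf_v_Suc:
  assumes "0 \<le> x" "x < 1" "\<forall>i<Suc n. cf_t x i \<noteq> 0"
  shows "cf_v x (Suc n) = 1 / (real (cf_digit x (Suc n)) + cf_v x n)"
  using assms cf_v_eq_cf_value[of x n] by (simp add: cf_v_Suc_eq_cf_value cf_digits_Suc)

lemma cf_value_range:
  assumes "\<forall>d\<in>set ds. 1 \<le> d"
  shows "0 \<le> (cf_value ds :: real)" "(cf_value ds :: real) \<le> 1"
  using assms
proof (induction ds)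
  case (Cons d ds)
  { case 1 then show ?case using Cons by simp }
  { case 2 then have "0 \<le> (cf_value ds :: real)" "1 \<le> real d" using Cons by simp_all
    then show ?case by (simp add: field_simps) }
qed simp_all

lemma cf_v_range:
  assumes "0 \<le> x" "x < 1" "\<forall>i<n. cf_t x i \<noteq> 0"
  shows "0 \<le> cf_v x n" "cf_v x n \<le> 1"
  using cf_value_range[of "rev (cf_digits x n)"] cf_digits_ge_1[OF assms]
  by (auto simp: cf_v_eq_cf_value[OF assms])

section \<open>Approximation coefficients in terms of future and past\<close>

text \<open>Write \<open>y = gauss_map x\<close>, so that \<open>x y = 1 - a\<^sub>1 x\<close>. Passing from the digits of \<open>y\<close> to those of \<open>x\<close>
sends the linear form \<open>D y - N\<close> to \<open>(a\<^sub>1 D + N) x - D = - x (D y - N)\<close>, so each shift contributes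
one factor of the orbit.\<close>

lemma convergent_error:
  assumes "0 \<le> x" "x < 1" "\<forall>i<n. cf_t x i \<noteq> 0"
  shows "\<bar>real (cf_den (cf_digits x n)) * x - real (cf_num (cf_digits x n))\<bar> = (\<Prod>i\<le>n. cf_t x i)"
  using assms
proof (induction n arbitrary: x)
  case (Suc n)
  define y where "y = cf_t x 1"
  define D N where "D = real (cf_den (cf_digits y n))" and "N = real (cf_num (cf_digits y n))"
  have y: "0 \<le> y" "y < 1" using cf_t_range Suc.prems y_def by auto
  have shift: "cf_t y i = cf_t x (Suc i)" for i by (simp add: y_def cf_t_add)
  have IH: "\<bar>D * y - N\<bar> = (\<Prod>i\<le>n. cf_t x (Suc i))"
    unfolding D_def N_def using Suc.IH[of y] y Suc.prems(3) by (simp add: shift)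
  have x: "x \<noteq> 0" using Suc.prems(3) by force
  then have "1 / x = real (cf_digit x 1) + y"
    using cf_t_step(2)[of x 0] Suc.prems by (simp add: y_def)
  then have "x * y = 1 - real (cf_digit x 1) * x" using x by (simp add: field_simps)
  then have "(real (cf_digit x 1) * D + N) * x - D = - x * (D * y - N)"
    by (simp add: algebra_simps) (metis mult.left_commute distrib_left right_diff_distrib diff_add_cancel mult.right_neutral)
  then have "\<bar>(real (cf_digit x 1) * D + N) * x - D\<bar> = x * (\<Prod>i\<le>n. cf_t x (Suc i))"
    using Suc.prems(1) IH by (simp add: abs_mult)
  then show ?case
    unfolding prod.atMost_Suc_shift cf_digits_Suc_front y_def[symmetric]
    by (simp add: D_def N_def)
qed simp

text \<open>This is \<open>q\<^sub>n + t\<^sub>n q\<^sub>n\<^sub>-\<^sub>1 = 1 / (t\<^sub>0 \<dots> t\<^sub>n\<^sub>-\<^sub>1)\<close> in a form that also covers \<open>n = 0\<close>. The step divides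
by \<open>t\<^sub>n\<close> and uses \<open>1 / t\<^sub>n = a\<^sub>n\<^sub>+\<^sub>1 + t\<^sub>n\<^sub>+\<^sub>1\<close> with the recurrence for the denominators.\<close>

lemma inverse_prod_cf_t:
  assumes "0 \<le> x" "x < 1" "\<forall>i<n. cf_t x i \<noteq> 0"
  shows "real (cf_den (cf_digits x n)) * (1 + cf_t x n * cf_v x n) * (\<Prod>i<n. cf_t x i) = 1"
  using assms
proof (induction n)
  case 0
  then show ?case by (simp add: cf_v_def)
next
  case (Suc n)
  have t: "cf_t x n \<noteq> 0" using Suc.prems by simp
  define a where "a = real (cf_digit x (Suc n))"
  have a: "1 / cf_t x n = a + cf_t x (Suc n)" "1 \<le> a"
    using cf_t_step[OF Suc.prems(1,2) t] by (simp_all add: a_def)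
  have pos: "0 < cf_den (cf_digits x n)" "0 < cf_den (cf_digits x (Suc n))"
    using cf_digits_ge_1[of x n] cf_digits_ge_1[of x "Suc n"] Suc.prems
    by (intro cf_den_pos; simp)+
  have v: "cf_v x (Suc n) = real (cf_den (cf_digits x n)) / real (cf_den (cf_digits x (Suc n)))"
    using Suc.prems by (simp add: cf_v_def conv_eq)
  have v': "cf_v x (Suc n) = 1 / (a + cf_v x n)" unfolding a_def by (rule cf_v_Suc[OF Suc.prems])
  have D: "real (cf_den (cf_digits x (Suc n))) = real (cf_den (cf_digits x n)) * (a + cf_v x n)"
  proof -
    have "0 < a + cf_v x n" using a cf_v_range(1)[of x n] Suc.prems by force
    then show ?thesis using v v' pos by (simp add: field_simps)
  qed
  have "real (cf_den (cf_digits x (Suc n))) * (1 + cf_t x (Suc n) * cf_v x (Suc n))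
      = real (cf_den (cf_digits x (Suc n))) + cf_t x (Suc n) * real (cf_den (cf_digits x n))"
    unfolding v using pos by (simp add: field_simps)
  also have "\<dots> = real (cf_den (cf_digits x n)) * (1 / cf_t x n + cf_v x n)"
    unfolding D a by (simp add: algebra_simps)
  finally have "real (cf_den (cf_digits x (Suc n))) * (1 + cf_t x (Suc n) * cf_v x (Suc n)) * cf_t x n
      = real (cf_den (cf_digits x n)) * (1 + cf_t x n * cf_v x n)"
    using t by (simp add: field_simps)
  moreover have "real (cf_den (cf_digits x n)) * (1 + cf_t x n * cf_v x n) * (\<Prod>i<n. cf_t x i) = 1"
    using Suc by simp
  ultimately show ?case unfolding prod.lessThan_Suc by (metis mult.assoc mult.commute)
qed

text \<open>The coefficient is \<open>q\<^sub>n\<close> times the error \<open>\<bar>q\<^sub>n x - p\<^sub>n\<bar> = t\<^sub>0 \<dots> t\<^sub>n\<close>, and the previous lemma evaluates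
\<open>q\<^sub>n t\<^sub>0 \<dots> t\<^sub>n\<^sub>-\<^sub>1\<close>.\<close>

lemma theta_eq:
  assumes "0 \<le> x" "x < 1" "\<forall>i<n. cf_t x i \<noteq> 0"
  shows "theta x n = cf_t x n / (1 + cf_t x n * cf_v x n)"
proof -
  define D N where "D = real (cf_den (cf_digits x n))" and "N = real (cf_num (cf_digits x n))"
  define P where "P = (\<Prod>i<n. cf_t x i)"
  define s where "s = 1 + cf_t x n * cf_v x n"
  have "0 < D" unfolding D_def using cf_den_pos[OF cf_digits_ge_1[OF assms]] by simp
  have "1 \<le> s" using cf_t_range[OF assms(1,2)] cf_v_range[OF assms] by (simp add: s_def)
  have "D * s * P = 1" using inverse_prod_cf_t[OF assms] by (simp add: D_def P_def s_def)
  then have P: "D * P = 1 / s" using \<open>1 \<le> s\<close> by (simp add: field_simps)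
  have "\<bar>x - N / D\<bar> = \<bar>D * x - N\<bar> / D"
    using \<open>0 < D\<close> by (simp add: field_simps flip: abs_div_pos)
  also have "\<bar>D * x - N\<bar> = P * cf_t x n"
    using convergent_error[OF assms] by (simp add: D_def N_def P_def lessThan_Suc_atMost[symmetric])
  finally have "theta x n = (D * P) * cf_t x n"
    using \<open>0 < D\<close> by (simp add: theta_def conv_eq[OF assms] D_def[symmetric] N_def[symmetric] power2_eq_square)
  then show ?thesis by (simp add: P s_def)
qed

text \<open>Both sides are the inverse of \<open>a\<^sub>n + t\<^sub>n + v\<^sub>n\<^sub>-\<^sub>1\<close>.\<close>

lemma theta_pred_eq:
  assumes "0 \<le> x" "x < 1" "\<forall>i<n. cf_t x i \<noteq> 0" "1 \<le> n"
  shows "theta x (n - 1) = cf_v x n / (1 + cf_t x n * cf_v x n)"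
proof -
  obtain m where n: "n = Suc m" using assms(4) by (cases n) auto
  define a where "a = real (cf_digit x n)"
  have nz: "cf_t x m \<noteq> 0" using assms n by simp
  have t: "1 / cf_t x m = a + cf_t x n" and "1 \<le> a"
    using cf_t_step[OF assms(1,2) nz] by (auto simp: n a_def)
  have v: "cf_v x n = 1 / (a + cf_v x m)" using cf_v_Suc assms by (simp add: n a_def)
  have "0 \<le> cf_v x m" using cf_v_range(1)[OF assms(1,2)] assms(3) n by simp
  have pos: "0 < cf_t x m" using cf_t_range(1)[OF assms(1,2), of m] nz by linarith
  have "cf_t x m / (1 + cf_t x m * cf_v x m) = 1 / (1 / cf_t x m + cf_v x m)"
    using pos \<open>0 \<le> cf_v x m\<close> by (simp add: field_simps)
  also have "\<dots> = cf_v x n / (1 + cf_t x n * cf_v x n)"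
    unfolding t v using \<open>0 \<le> cf_v x m\<close> \<open>1 \<le> a\<close> cf_t_range(1)[OF assms(1,2), of n]
    by (simp add: field_simps)
  finally show ?thesis using theta_eq[of x m] assms n by simp
qed

text \<open>A digit \<open>1\<close> moves \<open>(t, v)\<close> to \<open>(1 / t - 1, 1 / (1 + v))\<close>; substituting this into
the formula for \<open>\<Theta>\<close> clears all the nested fractions.\<close>

lemma theta_succ_eq:
  assumes "0 \<le> x" "x < 1" "\<forall>i<n. cf_t x i \<noteq> 0" "cf_digit x (n + 1) = 1"
  shows "theta x (n + 1) = (1 - cf_t x n) * (1 + cf_v x n) / (1 + cf_t x n * cf_v x n)"
proof -
  define t v where "t = cf_t x n" and "v = cf_v x n"
  have nz: "cf_t x n \<noteq> 0" using cf_t_nonzero_of_cf_digit assms(4) by simp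
  then have all: "\<forall>i<Suc n. cf_t x i \<noteq> 0" using assms(3) by (simp add: less_Suc_eq)
  have t: "cf_t x (Suc n) = 1 / t - 1" using cf_t_step(2)[OF assms(1,2) nz] assms(4) by (simp add: t_def)
  have v: "cf_v x (Suc n) = 1 / (1 + v)" using cf_v_Suc[OF assms(1,2) all] assms(4) by (simp add: v_def)
  have "0 < t" "t < 1" using cf_t_range[OF assms(1,2), of n] nz by (auto simp: t_def)
  have "0 \<le> v" using cf_v_range(1)[OF assms(1-3)] by (simp add: v_def)
  have *: "1 + (1 / t - 1) * (1 / (1 + v)) = (1 + t * v) / (t * (1 + v))"
    using \<open>0 < t\<close> \<open>0 \<le> v\<close> by (simp add: divide_simps add_nonneg_eq_0_iff) (simp add: algebra_simps)
  have "(1 / t - 1) / (1 + (1 / t - 1) * (1 / (1 + v))) = (1 - t) * (1 + v) / (1 + t * v)"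
    unfolding * using \<open>0 < t\<close> \<open>0 \<le> v\<close> by (simp add: divide_simps)
  then show ?thesis using theta_eq[OF assms(1,2) all] by (simp add: t v t_def v_def)
qed

section \<open>Numbers with prescribed initial digits\<close>

fun cf_prepend :: "nat list \<Rightarrow> real \<Rightarrow> real" where
  "cf_prepend [] s = s"
| "cf_prepend (d # ds) s = 1 / (real d + cf_prepend ds s)"

lemma cf_prepend_append: "cf_prepend (ds @ es) s = cf_prepend ds (cf_prepend es s)"
  by (induction ds) auto

lemma cf_value_append: "cf_value (ds @ es) = cf_prepend ds (cf_value es)"
  by (induction ds) auto

lemma cf_prepend_nonneg: "0 \<le> s \<Longrightarrow> 0 \<le> cf_prepend ds s"
  by (induction ds) auto

lemma cf_prepend_cf_t:
  assumes "0 \<le> x" "x < 1" "\<forall>i<n. cf_t x i \<noteq> 0"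
  shows "x = cf_prepend (cf_digits x n) (cf_t x n)"
  using assms(3)
proof (induction n)
  case (Suc n)
  then have "cf_t x n = 1 / (real (cf_digit x (Suc n)) + cf_t x (Suc n))"
    using cf_t_step(2)[OF assms(1,2), of n] by (metis div_by_1 divide_divide_eq_right lessI mult_1)
  then show ?case using Suc by (simp add: cf_digits_Suc cf_prepend_append)
qed simp

text \<open>The tail \<open>s\<close> is strictly between \<open>0\<close> and \<open>1\<close>, so \<open>\<lfloor>d + y\<rfloor> = d\<close> at every level. With \<open>s = 0\<close> the
claim would fail for lists that end in \<open>1\<close>, such as \<open>[2, 1]\<close>, whose value has the expansion \<open>[0; 3]\<close>.\<close>

lemma cf_prepend_expansion:
  assumes "\<forall>d\<in>set ds. 1 \<le> d" "0 < s" "s < 1"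
  shows "0 < cf_prepend ds s" "cf_prepend ds s < 1"
    and "cf_t (cf_prepend ds s) (length ds) = s" "cf_digits (cf_prepend ds s) (length ds) = ds"
  using assms(1)
proof (induction ds)
  case (Cons d ds)
  define y where "y = cf_prepend ds s"
  define x where "x = cf_prepend (d # ds) s"
  have y: "0 < y" "y < 1" "cf_t y (length ds) = s" "cf_digits y (length ds) = ds" "1 \<le> d"
    if "\<forall>d\<in>set (d # ds). 1 \<le> d"
    using Cons that by (auto simp: y_def)
  have x: "x = 1 / (real d + y)" by (simp add: x_def y_def)
  have digit: "cf_digit x 1 = d" "cf_t x 1 = y" if "\<forall>d\<in>set (d # ds). 1 \<le> d"
  proof -
    have "\<lfloor>1 / x\<rfloor> = int d" using y[OF that] by (simp add: x floor_eq_iff)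
    then show "cf_digit x 1 = d" "cf_t x 1 = y"
      using y[OF that] by (auto simp: cf_digit_def cf_t_def gauss_map_def x)
  qed
  { case 1 then show ?case using y(1)[OF 1] by (simp add: y_def) }
  { case 2 then show ?case using y(1)[OF 2] y(5)[OF 2] by (simp add: y_def) }
  { case 3 then show ?case
      using digit(2)[OF 3] y(3)[OF 3] cf_t_add[of x 1 "length ds"] by (simp add: x_def) }
  { case 4 then show ?case
      using digit[OF 4] y(4)[OF 4] unfolding x_def[symmetric] by (simp add: cf_digits_Suc_front) }
qed (use assms in auto)

section \<open>Blocks of ones\<close>

definition ones_prefix :: "nat \<Rightarrow> real \<Rightarrow> real" where
  "ones_prefix l s = cf_prepend (replicate l 1) s"

text \<open>The convergents of \<open>golden\<close>: \<open>ones k\<close> is \<open>c\<^sub>k\<^sub>-\<^sub>2\<close>, so that \<open>cf_c (int l)\<close> and \<open>cf_c (int l - 2)\<close> become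
\<open>ones (l + 2)\<close> and \<open>ones l\<close>.\<close>

definition ones :: "nat \<Rightarrow> real" where
  "ones k = ones_prefix k 0"

lemma ones_prefix_0 [simp]: "ones_prefix 0 s = s"
  by (simp add: ones_prefix_def)

lemma ones_prefix_Suc: "ones_prefix (Suc l) s = 1 / (1 + ones_prefix l s)"
  by (simp add: ones_prefix_def)

lemma ones_prefix_add: "ones_prefix (k + l) s = ones_prefix k (ones_prefix l s)"
  by (simp add: ones_prefix_def replicate_add cf_prepend_append)

lemma ones_prefix_nonneg: "0 \<le> s \<Longrightarrow> 0 \<le> ones_prefix l s"
  by (simp add: ones_prefix_def cf_prepend_nonneg)

lemma ones_0 [simp]: "ones 0 = 0"
  by (simp add: ones_def)

lemma ones_Suc: "ones (Suc k) = 1 / (1 + ones k)"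
  by (simp add: ones_def ones_prefix_Suc)

lemma ones_nonneg: "0 \<le> ones k"
  by (simp add: ones_def ones_prefix_nonneg)

lemma ones_le_1: "ones k \<le> 1"
  by (cases k) (simp_all add: ones_Suc ones_nonneg add_pos_nonneg)

lemma ones_pos: "1 \<le> k \<Longrightarrow> 0 < ones k"
  using ones_nonneg by (cases k) (auto simp: ones_Suc add_pos_nonneg)

lemma ones_less_1: "2 \<le> k \<Longrightarrow> ones k < 1"
  using ones_pos[of "k - 1"] by (cases k) (auto simp: ones_Suc)

text \<open>The final two ones of the block amount to a tail \<open>[0; 1, 1] = 1 / 2\<close>, the largest tail that a
first digit other than \<open>1\<close> permits.\<close>

lemma ones_add_2: "ones (l + 2) = ones_prefix l (1 / 2)"
  using ones_prefix_add[of l 2 0] by (simp add: ones_def numeral_2_eq_2 ones_prefix_Suc)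

lemma cf_value_replicate_1: "cf_value (replicate k 1) = ones k"
  by (induction k) (auto simp: ones_Suc)

lemma fib_ratio_eq_ones: "real (fib k) / real (fib (Suc k)) = ones k"
proof (induction k)
  case (Suc k)
  have "0 < fib (Suc k)" by (simp add: fib_neq_0_nat)
  then show ?case by (simp add: ones_Suc field_simps flip: Suc)
qed simp

lemma cf_c_eq_ones: "-1 \<le> m \<Longrightarrow> cf_c m = ones (nat (m + 2))"
proof -
  assume "-1 \<le> m"
  then have "nat (m + 3) = Suc (nat (m + 2))" by linarith
  then show ?thesis
    using fib_ratio_eq_ones[of "nat (m + 2)"] by (simp add: cf_c_def fib_F_def add.assoc)
qed

lemma cf_c_int: "cf_c (int l) = ones (l + 2)"
  by (simp add: cf_c_eq_ones nat_add_distrib)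

lemma cf_c_int_minus_2: "1 \<le> l \<Longrightarrow> cf_c (int l - 2) = ones l"
  by (simp add: cf_c_eq_ones)

lemma ones_prefix_strict_mono:
  assumes "0 \<le> s" "s < s'"
  shows "if even l then ones_prefix l s < ones_prefix l s' else ones_prefix l s' < ones_prefix l s"
proof (induction l)
  case (Suc l)
  have "0 \<le> ones_prefix l s" "0 \<le> ones_prefix l s'" using assms by (simp_all add: ones_prefix_nonneg)
  then show ?case using Suc by (auto simp: ones_prefix_Suc frac_less2 split: if_splits)
qed (use assms in simp)

lemma ones_prefix_mono:
  assumes "0 \<le> s" "s \<le> s'"
  shows "if even l then ones_prefix l s \<le> ones_prefix l s' else ones_prefix l s' \<le> ones_prefix l s"
  using ones_prefix_strict_mono[of s s' l] assms by (cases "s = s'") auto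

lemma golden_bounds: "1 / 2 < golden" "golden < 1"
proof -
  have "2 < sqrt 5" "sqrt 5 < 3" by (simp_all add: real_less_rsqrt real_less_lsqrt)
  then show "1 / 2 < golden" "golden < 1" by (simp_all add: golden_def)
qed

lemma golden_square: "golden * golden = 1 - golden"
  by (simp add: golden_def field_simps)

lemma sqrt_5_eq: "sqrt 5 = 1 + 2 * golden"
  by (simp add: golden_def field_simps)

lemma golden_fixpoint: "1 / (1 + golden) = golden"
  using golden_square golden_bounds by (simp add: field_simps)

lemma ones_prefix_golden: "ones_prefix l golden = golden"
  by (induction l) (simp_all add: ones_prefix_Suc golden_fixpoint)

text \<open>\<open>golden\<close> is a fixed point of every \<open>ones_prefix l\<close>, and \<open>ones k\<close> is the image of \<open>0 < golden\<close>; the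
parity of the block decides whether the order is kept.\<close>

lemma ones_golden:
  shows ones_less_golden: "even k \<Longrightarrow> ones k < golden"
    and golden_less_ones: "odd k \<Longrightarrow> golden < ones k"
  using ones_prefix_strict_mono[of 0 golden k] golden_bounds by (auto simp: ones_def ones_prefix_golden)

lemma ones_neq_golden: "ones k \<noteq> golden"
  using ones_golden[of k] by (cases "even k") auto

lemma ones_mono:
  assumes "j \<le> k"
  shows ones_even_mono: "even j \<Longrightarrow> ones j \<le> ones k"
    and ones_odd_antimono: "odd j \<Longrightarrow> ones k \<le> ones j"
proof -
  have "ones k = ones_prefix j (ones (k - j))"
    using assms ones_prefix_add[of j "k - j" 0] by (simp add: ones_def)
  then show "even j \<Longrightarrow> ones j \<le> ones k" "odd j \<Longrightarrow> ones k \<le> ones j"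
    using ones_prefix_mono[of 0 "ones (k - j)" j] ones_nonneg[of "k - j"] by (auto simp: ones_def)
qed

text \<open>Monotonicity in the tail: the tails \<open>0\<close> and \<open>1 / 2\<close> give \<open>ones l\<close> and \<open>ones (l + 2)\<close>.\<close>

lemma ones_prefix_bounds:
  assumes "0 \<le> s" "s \<le> 1 / 2"
  shows "even l \<Longrightarrow> ones l \<le> ones_prefix l s \<and> ones_prefix l s \<le> ones (l + 2)"
    and "odd l \<Longrightarrow> ones (l + 2) \<le> ones_prefix l s \<and> ones_prefix l s \<le> ones l"
  using ones_prefix_mono[of 0 s l] ones_prefix_mono[of s "1 / 2" l] assms
  unfolding ones_add_2 by (auto simp: ones_def)

text \<open>The digit after the block is not \<open>1\<close>, and it cannot be missing: a Gauss orbit stays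
below \<open>1\<close>, so no expansion ends in the digit \<open>1\<close>. Hence that digit is at least \<open>2\<close>, the
tail is positive, and it is at most \<open>1 / 2\<close>.\<close>

lemma future_ones_tail:
  assumes x: "0 \<le> x" "x < 1" and "future_ones x n l"
  obtains s where "0 < s" "s \<le> 1 / 2" "cf_t x n = ones_prefix l s"
proof -
  define y where "y = cf_t x n"
  define s where "s = cf_t y l"
  have y: "0 \<le> y" "y < 1" using cf_t_range[OF x] by (simp_all add: y_def)
  have l: "1 \<le> l" "cf_digits y l = replicate l 1" "cf_digit y (Suc l) \<noteq> 1"
    using assms(3) by (auto simp: future_ones_def y_def cf_digit_shift)
  then have "cf_digit y l = 1"
    by (cases l) (auto simp: cf_digits_Suc replicate_append_same[symmetric])
  then have nz: "cf_t y (l - 1) \<noteq> 0" using l(1) cf_t_nonzero_of_cf_digit[of y "l - 1"] by simp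
  then have all: "\<forall>i<l. cf_t y i \<noteq> 0"
    by (metis Suc_leI Suc_diff_1 cf_t_nonzero_antimono l(1) less_Suc_eq_le less_le_trans zero_less_one)
  have s: "0 \<le> s" "s < 1" using cf_t_range[OF y] by (simp_all add: s_def)
  have ne0: "s \<noteq> 0"
  proof
    assume "s = 0"
    then have "1 / cf_t y (l - 1) = 1"
      using cf_t_step(2)[OF y nz] \<open>cf_digit y l = 1\<close> l(1) by (simp add: s_def)
    then show False using cf_t_range(2)[OF y, of "l - 1"] by simp
  qed
  have "s \<le> 1 / 2"
  proof -
    have "1 \<le> cf_digit y (Suc l)" "1 / s = real (cf_digit y (Suc l)) + cf_t y (Suc l)"
      using cf_t_step[OF y, of l] ne0 by (simp_all add: s_def)
    then have "2 \<le> 1 / s" using l(3) cf_t_range(1)[OF y, of "Suc l"] by linarith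
    then show ?thesis using s ne0 by (simp add: field_simps)
  qed
  moreover have "y = ones_prefix l s"
    using cf_prepend_cf_t[OF y all] by (simp add: l(2) ones_prefix_def s_def)
  ultimately show thesis using that[of s] s ne0 by (simp add: y_def)
qed

text \<open>Unlike the future, the past may end with its block of ones, at \<open>a\<^sub>1\<close>; then the tail is \<open>0\<close>.
Otherwise the digit after the block is at least \<open>2\<close>.\<close>

lemma past_ones_tail:
  assumes x: "0 \<le> x" "x < 1" and nz: "\<forall>i<n. cf_t x i \<noteq> 0" and "past_ones x n h"
  obtains s where "0 \<le> s" "s \<le> 1 / 2" "h < n \<Longrightarrow> 0 < s" "cf_v x n = ones_prefix h s"
proof -
  define s where "s = (cf_value (rev (cf_digits x (n - h))) :: real)"
  have v: "cf_v x n = ones_prefix h s" and h: "h \<le> n" "h < n \<longrightarrow> cf_digit x (n - h) \<noteq> 1"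
    using assms(4) by (simp_all add: past_ones_def cf_value_append ones_prefix_def s_def)
  show thesis
  proof (cases "h = n")
    case True
    then show thesis using that[of 0] v by (simp add: s_def)
  next
    case False
    then obtain m where m: "n - h = Suc m" using h by (metis diff_is_0_eq le_antisym not0_implies_Suc)
    define r where "r = (cf_value (rev (cf_digits x m)) :: real)"
    have "\<forall>i<m. cf_t x i \<noteq> 0" using nz m by auto
    then have "0 \<le> r"
      using cf_digits_ge_1[OF x, of m] by (auto simp: r_def intro: cf_value_range)
    moreover have "1 \<le> cf_digit x (Suc m)"
      using cf_t_step(1)[OF x, of m] nz m by simp
    then have "2 \<le> real (cf_digit x (Suc m))" using h False m by force
    moreover have "s = 1 / (real (cf_digit x (Suc m)) + r)"
      by (simp add: s_def m r_def cf_digits_Suc)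
    ultimately have "0 < s" "s \<le> 1 / 2" by (simp_all add: divide_le_eq)
    then show thesis using that[of s] v by simp
  qed
qed

section \<open>Three consecutive coefficients and Borel's inequality\<close>

definition theta_pred :: "real \<Rightarrow> real \<Rightarrow> real" where
  "theta_pred t v = v / (1 + t * v)"

definition theta_here :: "real \<Rightarrow> real \<Rightarrow> real" where
  "theta_here t v = t / (1 + t * v)"

definition theta_succ :: "real \<Rightarrow> real \<Rightarrow> real" where
  "theta_succ t v = (1 - t) * (1 + v) / (1 + t * v)"

definition borel_min :: "real \<Rightarrow> real \<Rightarrow> real" where
  "borel_min t v = min (min t v) ((1 - t) * (1 + v)) / (1 + t * v)"

lemma theta_eqs:
  assumes "0 \<le> x" "x < 1" "\<forall>i<n. cf_t x i \<noteq> 0" "1 \<le> n" "cf_digit x (n + 1) = 1"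
  shows "theta x (n - 1) = theta_pred (cf_t x n) (cf_v x n)"
    and "theta x n = theta_here (cf_t x n) (cf_v x n)"
    and "theta x (n + 1) = theta_succ (cf_t x n) (cf_v x n)"
  using theta_pred_eq theta_eq theta_succ_eq assms
  by (simp_all add: theta_pred_def theta_here_def theta_succ_def)

lemma borel_min_le:
  assumes "0 \<le> t" "0 \<le> v"
  shows "borel_min t v \<le> theta_pred t v" "borel_min t v \<le> theta_here t v"
    "borel_min t v \<le> theta_succ t v"
  using assms by (auto simp: borel_min_def theta_pred_def theta_here_def theta_succ_def
      intro!: divide_right_mono)

lemma borel_min_eq:
  assumes "0 \<le> t" "0 \<le> v"
  shows "borel_min t v = min (min (theta_here t v) (theta_pred t v)) (theta_succ t v)"
  using assms
  by (simp add: borel_min_def theta_pred_def theta_here_def theta_succ_def min_divide_distrib_right)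

lemma theta_here_mono:
  assumes "0 \<le> t" "t \<le> t'" "0 \<le> v'" "v' \<le> v"
  shows "theta_here t v \<le> theta_here t' v'"
proof -
  have "t * (1 + t' * v') \<le> t' * (1 + t * v)"
    using assms mult_mono[of "t * t'" "t * t'" v' v] by (simp add: algebra_simps)
  then show ?thesis using assms
    by (simp add: theta_here_def divide_le_eq le_divide_eq add_pos_nonneg mult.commute)
qed

lemma theta_pred_mono:
  assumes "0 \<le> v" "v \<le> v'" "0 \<le> t'" "t' \<le> t"
  shows "theta_pred t v \<le> theta_pred t' v'"
  using theta_here_mono[OF assms] by (simp add: theta_pred_def theta_here_def mult.commute)

lemma theta_succ_mono:
  assumes "0 \<le> t'" "t' \<le> t" "t \<le> 1" "0 \<le> v" "v \<le> v'"
  shows "theta_succ t v \<le> theta_succ t' v'"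
proof -
  have "(1 - t') * (1 + v') * (1 + t * v) - (1 - t) * (1 + v) * (1 + t' * v')
      = (1 + v) * (1 + v') * (t - t') + (1 - t) * (1 - t') * (v' - v)"
    by algebra
  also have "\<dots> \<ge> 0" using assms by (intro add_nonneg_nonneg mult_nonneg_nonneg) auto
  finally show ?thesis using assms
    by (simp add: theta_succ_def divide_le_eq le_divide_eq add_pos_nonneg mult.commute mult.left_commute)
qed

lemma golden_over_one_plus_square: "1 / sqrt 5 = golden / (1 + golden * golden)"
  using golden_bounds by (simp add: sqrt_5_eq golden_square field_simps) (use golden_square in algebra)

text \<open>Borel's inequality on the cylinder \<open>a\<^sub>n\<^sub>+\<^sub>1 = 1\<close>. If all three coefficients were at least
\<open>1 / sqrt 5\<close>, the first two would confine \<open>v\<close> between \<open>1 / (sqrt 5 - t)\<close> and \<open>sqrt 5 - 1 / t\<close>, which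
forces \<open>golden \<le> t\<close>; inserting the upper limit for \<open>v\<close> into the third gives a quadratic
inequality in \<open>t\<close> that forces \<open>t \<le> golden\<close>.\<close>

lemma borel_min_less:
  assumes t: "0 \<le> t" "t \<le> 1" and v: "0 \<le> v" "v \<le> 1" and "t \<noteq> golden"
  shows "borel_min t v < 1 / sqrt 5"
proof (rule ccontr)
  define r where "r = sqrt 5"
  have g: "r = 1 + 2 * golden" by (simp add: r_def sqrt_5_eq)
  have r: "0 < r" by (simp add: r_def)
  assume "\<not> ?thesis"
  then have "1 / r \<le> borel_min t v" by (simp add: r_def)
  then have "(1 / r) * (1 + t * v) \<le> min (min t v) ((1 - t) * (1 + v))"
    using t v by (simp add: borel_min_def le_divide_eq add_pos_nonneg)
  then have "1 + t * v \<le> r * t" "1 + t * v \<le> r * v" "1 + t * v \<le> r * ((1 - t) * (1 + v))"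
    using r by (simp_all add: field_simps)
  then have a: "1 + t * v \<le> r * t" and b: "1 \<le> v * (r - t)"
    and c: "1 - r * (1 - t) \<le> v * (r * (1 - t) - t)" by (simp_all add: algebra_simps)
  have tpos: "0 < t"
  proof (rule ccontr)
    assume "\<not> 0 < t" then have "t = 0" using t by simp then show False using a by simp
  qed
  have rt: "0 < r - t" using t g golden_bounds by simp
  have vt: "v * t \<le> r * t - 1" using a by (simp add: mult.commute)
  have "t \<le> v * t * (r - t)" using b tpos by (simp add: mult.commute mult.assoc)
  also have "\<dots> \<le> (r * t - 1) * (r - t)" using vt rt by (intro mult_right_mono) auto
  finally have "t \<le> (r * t - 1) * (r - t)" .
  moreover have "(r * t - 1) * (r - t) - t = r * ((t - golden) * (golden + 1 - t))"
    using golden_square g by algebra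
  ultimately have "0 \<le> r * ((t - golden) * (golden + 1 - t))" by linarith
  moreover have "0 < golden + 1 - t" using t golden_bounds by simp
  ultimately have lower: "golden \<le> t"
    using r by (simp add: zero_le_mult_iff)
  \<comment> \<open>the third inequality survives replacing \<open>v\<close> by its upper limit because its factor is nonnegative\<close>
  have coeff: "0 \<le> r * (1 - t) - t"
  proof (rule ccontr)
    assume neg: "\<not> ?thesis"
    then have "v * (r * (1 - t) - t) \<le> 0" using v by (intro mult_nonneg_nonpos) auto
    then show False using c neg t by linarith
  qed
  have "t * (1 - r * (1 - t)) \<le> t * (v * (r * (1 - t) - t))" using c tpos by (intro mult_left_mono) auto
  also have "\<dots> = v * t * (r * (1 - t) - t)" by (simp add: mult.commute mult.left_commute)
  also have "\<dots> \<le> (r * t - 1) * (r * (1 - t) - t)" using vt coeff by (rule mult_right_mono)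
  \<comment> \<open>the roots of the resulting quadratic are \<open>golden\<close> and \<open>1 - golden\<close>\<close>
  finally have "t * (1 - r * (1 - t)) \<le> (r * t - 1) * (r * (1 - t) - t)" .
  moreover have "(r * t - 1) * (r * (1 - t) - t) - t * (1 - r * (1 - t))
      = - ((5 + 2 * r) * ((t - golden) * (t - (1 - golden))))"
    using golden_square g by algebra
  ultimately have "(5 + 2 * r) * ((t - golden) * (t - (1 - golden))) \<le> 0" by linarith
  moreover have "0 < (5 + 2 * r) * ((t - golden) * (t - (1 - golden)))"
    using r lower assms(5) golden_bounds by (intro mult_pos_pos) auto
  ultimately show False by linarith
qed

section \<open>Further estimates for the minimum\<close>

text \<open>For fixed \<open>t\<close> the coefficient \<open>theta_here\<close> decreases in \<open>v\<close> and \<open>theta_succ\<close> increases, so their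
minimum is largest where they agree, at \<open>v = (2 t - 1) / (1 - t)\<close>; the right-hand side is the common
value there.\<close>

lemma min_here_succ_le:
  assumes t: "1 / 2 \<le> t" "t < 1" and v: "0 \<le> v"
  shows "borel_min t v \<le> t * (1 - t) / (2 * t\<^sup>2 - 2 * t + 1)"
proof -
  have D: "0 < 2 * t\<^sup>2 - 2 * t + 1"
    using sum_power2_gt_zero_iff[of t "1 - t"] t by (simp add: power2_eq_square algebra_simps)
  have p: "0 < 1 + t * v" using t v by (simp add: add_pos_nonneg)
  show ?thesis
  proof (cases "2 * t - 1 \<le> (1 - t) * v")
    case True
    have "t * (2 * t - 1) \<le> t * ((1 - t) * v)" using True t by (intro mult_left_mono) auto
    then have "2 * t\<^sup>2 - 2 * t + 1 \<le> (1 - t) * (1 + t * v)"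
      by (simp add: power2_eq_square algebra_simps)
    then have "t * (2 * t\<^sup>2 - 2 * t + 1) \<le> t * ((1 - t) * (1 + t * v))" using t by (intro mult_left_mono) auto
    then have "theta_here t v \<le> t * (1 - t) / (2 * t\<^sup>2 - 2 * t + 1)"
      using D p by (simp only: theta_here_def divide_le_eq le_divide_eq times_divide_eq_left if_True mult.assoc)
    then show ?thesis using borel_min_le(2)[of t v] t v by linarith
  next
    case False
    have "t * (1 - t) * (1 + t * v) - (1 - t) * (1 + v) * (2 * t\<^sup>2 - 2 * t + 1)
        = (1 - t) * ((1 - t) * (2 * t - 1 - (1 - t) * v))" by algebra
    also have "\<dots> \<ge> 0" using False t by (intro mult_nonneg_nonneg) auto
    finally have "theta_succ t v \<le> t * (1 - t) / (2 * t\<^sup>2 - 2 * t + 1)"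
      using D p by (simp add: theta_succ_def divide_le_eq le_divide_eq)
    then show ?thesis using borel_min_le(3)[of t v] t v by linarith
  qed
qed

text \<open>In terms of \<open>u = t (1 - t)\<close> the expression is \<open>u / (1 - 2 u)\<close>, which increases in \<open>u\<close>, while \<open>u\<close> decreases
for \<open>t \<ge> 1 / 2\<close>.\<close>

lemma here_succ_curve_antimono:
  assumes "1 / 2 \<le> a" "a \<le> t" "t \<le> 1"
  shows "t * (1 - t) / (2 * t\<^sup>2 - 2 * t + 1) \<le> a * (1 - a) / (2 * a\<^sup>2 - 2 * a + (1::real))"
proof -
  have D: "0 < 2 * x\<^sup>2 - 2 * x + 1" for x :: real
    using sum_power2_gt_zero_iff[of x "1 - x"] by (cases "x = 0") (auto simp: power2_eq_square algebra_simps)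
  have "a * (1 - a) * (2 * t\<^sup>2 - 2 * t + 1) - t * (1 - t) * (2 * a\<^sup>2 - 2 * a + 1) = (t - a) * (a + t - 1)"
    by algebra
  also have "\<dots> \<ge> 0" using assms by (intro mult_nonneg_nonneg) auto
  finally show ?thesis using D[of t] D[of a] by (simp add: divide_le_eq le_divide_eq)
qed

text \<open>With \<open>m = min t v\<close>, moving the larger coordinate down to \<open>m\<close> does not decrease the relevant
coefficient, so the diagonal value \<open>m / (1 + m\<^sup>2)\<close>, increasing on \<open>[0, 1]\<close>, is an upper bound.\<close>

lemma borel_min_le_diagonal:
  assumes "0 \<le> t" "0 \<le> v" "t \<le> A" "A \<le> 1"
  shows "borel_min t v \<le> A / (1 + A\<^sup>2)"
proof -
  define m where "m = min t v"
  have "borel_min t v \<le> m / (1 + m * m)"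
    using assms borel_min_le(1,2)[of t v] theta_here_mono[of t t t v] theta_pred_mono[of v v v t]
    by (cases "t \<le> v") (auto simp: m_def theta_here_def theta_pred_def)
  also have "\<dots> \<le> A / (1 + A * A)"
  proof -
    have m: "0 \<le> m" "m \<le> A" using assms by (auto simp: m_def)
    have "A * (1 + m * m) - m * (1 + A * A) = (A - m) * (1 - A * m)" by algebra
    also have "\<dots> \<ge> 0" using m assms mult_mono[of A 1 m 1] by (intro mult_nonneg_nonneg) auto
    finally show ?thesis by (simp add: divide_le_eq le_divide_eq add_pos_nonneg)
  qed
  finally show ?thesis by (simp add: power2_eq_square)
qed

section \<open>The Borel constants as values at corners\<close>

lemma ones_add_2_less_1: "ones (l + 2) < 1"
  by (rule ones_less_1) simp

lemma ones_last_step: "ones (Suc k) * (1 + ones k) = 1"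
  using ones_nonneg[of k] by (simp add: ones_Suc)

text \<open>The corner \<open>(ones (l + 2), ones l)\<close> lies on the curve \<open>t = (1 - t) (1 + v)\<close> where
\<open>theta_here\<close> and \<open>theta_succ\<close> agree. This explains why a Borel constant can be
written in several ways.\<close>

lemma here_eq_succ_at_ones: "(1 - ones (l + 2)) * (1 + ones l) = ones (l + 2)"
proof -
  have "0 < 1 + ones l" "0 < 2 + ones l" using ones_nonneg[of l] by linarith+
  then have "ones (l + 2) = (1 + ones l) / (2 + ones l)"
    by (simp add: ones_Suc divide_simps)
  then show ?thesis using \<open>0 < 2 + ones l\<close> by (simp add: field_simps)
qed

lemma succ_ge_pred_iff: "v \<le> (1 - t) * (1 + v) \<longleftrightarrow> t * v \<le> 1 - t" for t v :: real
  by (simp add: algebra_simps)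

lemma ones_mult_ones_Suc: "ones (Suc k) * ones k = 1 - ones (Suc k)"
  using ones_last_step[of k] by (simp add: algebra_simps)

lemma below_golden_succ_ge:
  assumes "0 \<le> t" "t < golden" "0 \<le> v" "v < golden"
  shows "v \<le> (1 - t) * (1 + v)"
proof -
  have "t * v \<le> golden * golden" using assms by (intro mult_mono) auto
  then show ?thesis using assms by (simp add: succ_ge_pred_iff golden_square)
qed

text \<open>The rectangle of possible pairs \<open>(t, v)\<close> has the corners listed in the first two
conclusions. Each Borel constant is the value of one of the three coefficients at one of
these corners; the content of the case distinction is that this coefficient is the smallest
of the three there. This single fact yields both the bound \<open>1 / sqrt 5\<close> and optimality.\<close>

lemma borel_const_corner:
  assumes l: "1 \<le> l" and h: "1 \<le> h"
  obtains t v where "t = ones (l + 2) \<or> t = ones l" "v = ones (h + 2) \<or> v = ones h"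
    "borel_const l h = borel_min t v"
proof -
  define A a B b where "A = ones (l + 2)" and "a = ones l" and "B = ones (h + 2)" and "b = ones h"
  note defs = A_def a_def B_def b_def
  have K: "borel_const l h =
    (if odd l \<and> odd h then
       (if h = l then A / (1 + a * A)
        else if h + 2 = l then A * (1 - A) / (2 * A\<^sup>2 - 2 * A + 1)
        else if h + 2 < l then a / (1 + a * B)
        else (1 - A) * (1 + b) / (1 + A * b))
     else if odd l \<and> even h then
       (if h \<ge> l + 1 then (1 - A) * (1 + B) / (1 + A * B) else B / (1 + A * B))
     else if even l \<and> odd h then A / (1 + A * B)
     else (if h = l then A / (1 + A\<^sup>2)
        else if h \<ge> l + 2 then A / (1 + b * A) else B / (1 + a * B)))"
    using cf_c_int[of l] cf_c_int[of h] cf_c_int_minus_2[OF l] cf_c_int_minus_2[OF h]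
    by (simp add: borel_const_def Let_def defs)
  have A: "0 \<le> A" "A < 1" and a: "0 \<le> a" and B: "0 \<le> B" and b: "0 \<le> b"
    by (simp_all only: defs ones_nonneg ones_add_2_less_1)
  have AC: "(1 - A) * (1 + a) = A" unfolding defs by (rule here_eq_succ_at_ones)
  have AS: "A * ones (l + 1) = 1 - A"
    using ones_mult_ones_Suc[of "l + 1"] by (simp add: defs)
  note P = that[unfolded borel_min_def, folded defs]
  consider (1) "odd l" "h = l" | (2) "odd l" "h + 2 = l" | (3) "odd l" "odd h" "h + 2 < l"
    | (4) "odd l" "odd h" "l < h" | (5) "odd l" "even h" "l + 1 \<le> h" | (6) "odd l" "even h" "h + 1 \<le> l"
    | (7) "even l" "odd h" | (8) "even l" "h = l" | (9) "even l" "even h" "l + 2 \<le> h"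
    | (10) "even l" "even h" "h + 2 \<le> l"
  proof (cases "odd l")
    case True
    then have "h = l \<or> h + 2 = l \<or> odd h \<and> h + 2 < l \<or> odd h \<and> l < h
        \<or> even h \<and> l + 1 \<le> h \<or> even h \<and> h + 1 \<le> l"
      by presburger
    then show thesis using that(1-6) True by metis
  next
    case False
    then have "odd h \<or> h = l \<or> even h \<and> l + 2 \<le> h \<or> even h \<and> h + 2 \<le> l" by presburger
    then show thesis using that(7-10) False by metis
  qed
  then show thesis
  proof cases
    case 1
    then have "A \<le> b" using ones_odd_antimono[of l "l + 2"] by (simp add: defs)
    moreover have "b = a" using 1 by (simp add: defs)
    moreover have "borel_const l h = A / (1 + A * a)" using 1 unfolding K by (simp add: mult.commute)
    ultimately show thesis using P[of A b] AC by simp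
  next
    case 2
    then have "B = a" by (simp add: defs)
    have "A \<le> a" using 2 ones_odd_antimono[of l "l + 2"] by (simp add: defs)
    have "a * (1 - A) = 2 * A - 1" using AC by (simp add: algebra_simps)
    have "A * (1 - A) * (1 + a * A) = A * (1 - A + A * (a * (1 - A)))" by algebra
    also have "\<dots> = A * (2 * A\<^sup>2 - 2 * A + 1)" unfolding \<open>a * (1 - A) = _\<close> by algebra
    finally have "A * (1 - A) * (1 + a * A) = A * (2 * A\<^sup>2 - 2 * A + 1)" .
    moreover have "0 < 1 + a * A" "0 < 2 * A\<^sup>2 - 2 * A + 1"
      using a A sum_power2_gt_zero_iff[of A "1 - A"]
      by (auto simp: add_pos_nonneg power2_eq_square algebra_simps)
    ultimately have "A * (1 - A) / (2 * A\<^sup>2 - 2 * A + 1) = A / (1 + a * A)"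
      by (simp add: divide_simps)
    moreover have "odd h" "h \<noteq> l" using 2 by presburger+
    ultimately have "borel_const l h = A / (1 + A * a)" using 2 unfolding K by (simp add: mult.commute)
    then show thesis using P[of A B] AC \<open>B = a\<close> \<open>A \<le> a\<close> by simp
  next
    case 3
    then have "a \<le> B" using ones_odd_antimono[of "h + 2" l] by (simp add: defs)
    have "h + 2 \<le> l - 2" "l - 2 + 2 = l" using 3 by presburger+
    have "ones (l - 2) \<le> B" using 3 \<open>h + 2 \<le> l - 2\<close> ones_odd_antimono[of "h + 2" "l - 2"] by (simp add: defs)
    moreover have "(1 - a) * (1 + ones (l - 2)) = a"
      using here_eq_succ_at_ones[of "l - 2"] unfolding defs \<open>l - 2 + 2 = l\<close> .
    moreover have "0 \<le> 1 - a" using ones_le_1[of l] by (simp add: defs)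
    ultimately have "a \<le> (1 - a) * (1 + B)"
      using mult_left_mono[of "1 + ones (l - 2)" "1 + B" "1 - a"] by simp
    then show thesis using 3 P[of a B] \<open>a \<le> B\<close> by (simp add: K)
  next
    case 4
    then have "l + 2 \<le> h" by presburger
    then have "b \<le> A" using 4 ones_odd_antimono[of "l + 2" h] by (simp add: defs)
    \<comment> \<open>the value \<open>v = ones (l + 1)\<close> is where \<open>theta_pred\<close> and \<open>theta_succ\<close> agree for \<open>t = ones (l + 2)\<close>\<close>
    have "ones (l + 1) \<le> b"
      using 4 ones_less_golden[of "l + 1"] golden_less_ones[of h] by (simp add: defs)
    then have "1 - A \<le> A * b" using AS A mult_left_mono[of "ones (l + 1)" b A] by simp
    then have "(1 - A) * (1 + b) \<le> b" by (simp add: algebra_simps)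
    then show thesis using 4 P[of A b] \<open>b \<le> A\<close> by (simp add: K)
  next
    case 5
    have "B \<le> A" using 5 ones_less_golden[of "h + 2"] golden_less_ones[of "l + 2"] by (simp add: defs)
    have "ones (l + 1) \<le> B" using 5 ones_even_mono[of "l + 1" "h + 2"] by (simp add: defs)
    then have "1 - A \<le> A * B" using AS A mult_left_mono[of "ones (l + 1)" B A] by simp
    then have "(1 - A) * (1 + B) \<le> B" by (simp add: algebra_simps)
    then show thesis using 5 P[of A B] \<open>B \<le> A\<close> by (simp add: K)
  next
    case 6
    have "B \<le> A" using 6 ones_less_golden[of "h + 2"] golden_less_ones[of "l + 2"] by (simp add: defs)
    have "B \<le> ones (l + 1)" using 6 ones_even_mono[of "h + 2" "l + 1"] by (simp add: defs)
    then have "A * B \<le> 1 - A" using AS A mult_left_mono[of B "ones (l + 1)" A] by simp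
    then have "B \<le> (1 - A) * (1 + B)" by (simp add: algebra_simps)
    then show thesis using 6 P[of A B] \<open>B \<le> A\<close> by (simp add: K)
  next
    case 7
    have "A < golden" "golden < B"
      using 7 ones_less_golden[of "l + 2"] golden_less_ones[of "h + 2"] by (simp_all add: defs)
    then have "A \<le> (1 - A) * (1 + A)" "(1 - A) * (1 + A) \<le> (1 - A) * (1 + B)"
      using below_golden_succ_ge[of A A] A by (auto intro!: mult_left_mono)
    then show thesis using 7 P[of A B] \<open>A < golden\<close> \<open>golden < B\<close> by (simp add: K)
  next
    case 8
    have "A < golden" "B = A" using 8 ones_less_golden[of "l + 2"] by (simp_all add: defs)
    moreover have "borel_const l h = A / (1 + A * A)" using 8 unfolding K by (simp add: power2_eq_square)
    ultimately show thesis using P[of A B] A below_golden_succ_ge[of A A] by simp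
  next
    case 9
    have "A < golden" "b < golden"
      using 9 ones_less_golden[of "l + 2"] ones_less_golden[of h] by (simp_all add: defs)
    have "A \<le> b" using 9 ones_even_mono[of "l + 2" h] by (simp add: defs)
    then have "A \<le> (1 - A) * (1 + b)"
      using below_golden_succ_ge[of A b] A b \<open>A < golden\<close> \<open>b < golden\<close> by linarith
    then show thesis using 9 P[of A b] \<open>A \<le> b\<close> by (simp add: K mult.commute)
  next
    case 10
    have "a < golden" "B < golden"
      using 10 ones_less_golden[of l] ones_less_golden[of "h + 2"] by (simp_all add: defs)
    have "B \<le> a" using 10 ones_even_mono[of "h + 2" l] by (simp add: defs)
    then show thesis using 10 P[of a B] below_golden_succ_ge[of a B] a B \<open>a < golden\<close> \<open>B < golden\<close>
      by (simp add: K)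
  qed
qed

lemma borel_const_less:
  assumes "1 \<le> l" "1 \<le> h"
  shows "borel_const l h < 1 / sqrt 5"
proof -
  obtain t v where tv: "t = ones (l + 2) \<or> t = ones l" "v = ones (h + 2) \<or> v = ones h"
    and K: "borel_const l h = borel_min t v"
    using borel_const_corner[OF assms] .
  have "0 \<le> t" "t \<le> 1" "0 \<le> v" "v \<le> 1" "t \<noteq> golden"
    using tv by (metis ones_nonneg ones_le_1 ones_neq_golden)+
  then show ?thesis unfolding K by (rule borel_min_less)
qed

section \<open>The Borel constants as upper bounds\<close>

text \<open>On the rectangle a single coefficient already has the right maximum, by its monotonicity in
\<open>t\<close> and \<open>v\<close>, except in two cases where two coefficients must be combined: \<open>h = l\<close> even, where
the maximum lies on the diagonal, and \<open>l\<close> odd with \<open>h + 2 = l\<close>, where it lies on the curve along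
which \<open>theta_here\<close> and \<open>theta_succ\<close> agree.\<close>

lemma borel_min_le_borel_const:
  assumes l: "1 \<le> l" and h: "1 \<le> h"
    and t: "even l \<Longrightarrow> ones l \<le> t \<and> t \<le> ones (l + 2)" "odd l \<Longrightarrow> ones (l + 2) \<le> t \<and> t \<le> ones l"
    and v: "even h \<Longrightarrow> ones h \<le> v \<and> v \<le> ones (h + 2)" "odd h \<Longrightarrow> ones (h + 2) \<le> v \<and> v \<le> ones h"
    and "t < 1"
  shows "borel_min t v \<le> borel_const l h"
proof -
  define A a B b where "A = ones (l + 2)" and "a = ones l" and "B = ones (h + 2)" and "b = ones h"
  note defs = A_def a_def B_def b_def
  have K: "borel_const l h =
    (if odd l \<and> odd h then
       (if h = l then A / (1 + a * A)
        else if h + 2 = l then A * (1 - A) / (2 * A\<^sup>2 - 2 * A + 1)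
        else if h + 2 < l then theta_here a B
        else theta_succ A b)
     else if odd l \<and> even h then (if h \<ge> l + 1 then theta_succ A B else theta_pred A B)
     else if even l \<and> odd h then theta_here A B
     else (if h = l then A / (1 + A\<^sup>2) else if h \<ge> l + 2 then theta_here A b else theta_pred a B))"
    using cf_c_int[of l] cf_c_int[of h] cf_c_int_minus_2[OF l] cf_c_int_minus_2[OF h]
    by (simp add: borel_const_def Let_def defs theta_here_def theta_pred_def theta_succ_def mult.commute)
  have A: "0 \<le> A" "A < 1" and a: "0 \<le> a" and B: "0 \<le> B" and b: "0 \<le> b"
    by (simp_all only: defs ones_nonneg ones_add_2_less_1)
  have te: "even l \<Longrightarrow> a \<le> t" "even l \<Longrightarrow> t \<le> A" and to: "odd l \<Longrightarrow> A \<le> t" "odd l \<Longrightarrow> t \<le> a"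
    and ve: "even h \<Longrightarrow> b \<le> v" "even h \<Longrightarrow> v \<le> B" and vo: "odd h \<Longrightarrow> B \<le> v" "odd h \<Longrightarrow> v \<le> b"
    using t v by (auto simp: defs)
  have t0: "0 \<le> t" using te to A a by (cases "even l") force+
  have v0: "0 \<le> v" using ve vo B b by (cases "even h") force+
  have AC: "(1 - A) * (1 + a) = A" unfolding defs by (rule here_eq_succ_at_ones)
  note up = borel_min_le[OF t0 v0]
  show ?thesis
  proof (cases "odd l")
    case ol: True
    show ?thesis
    proof (cases "odd h")
      case oh: True
      have "h < l \<Longrightarrow> h + 2 \<le> l" using ol oh by presburger
      then consider "h = l" | "h + 2 = l" | "h + 2 < l" | "h > l" by linarith
      then show ?thesis
      proof cases
        case 1
        then have "b = a" by (simp add: defs)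
        then have "borel_const l h = theta_succ A b" using 1 ol AC unfolding K by (simp add: theta_succ_def mult.commute)
        then show ?thesis using up(3) theta_succ_mono[of A t v b] A to vo ol oh v0 \<open>t < 1\<close> by linarith
      next
        case 2
        have "1 / 2 \<le> A" using golden_less_ones[of "l + 2"] golden_bounds ol by (simp add: defs)
        then show ?thesis
          using 2 ol oh min_here_succ_le[of t v] here_succ_curve_antimono[of A t] to v0 \<open>t < 1\<close> by (simp add: K)
      next
        case 3
        then show ?thesis using ol oh up(2) theta_here_mono[of t a B v] t0 to B vo by (simp add: K)
      next
        case 4
        then show ?thesis using up(3) theta_succ_mono[of A t v b] A to vo ol oh v0 \<open>t < 1\<close> by (simp add: K)
      qed
    next
      case eh: False
      then show ?thesis
        using ol up(1,3) theta_succ_mono[of A t v B] theta_pred_mono[of v B A t] A to ve v0 \<open>t < 1\<close>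
        by (simp add: K)
    qed
  next
    case el: False
    show ?thesis
    proof (cases "odd h")
      case oh: True
      then show ?thesis using el up(2) theta_here_mono[of t A B v] t0 te B vo by (simp add: K)
    next
      case eh: False
      have "l < h \<Longrightarrow> l + 2 \<le> h" using el eh by presburger
      then consider "h = l" | "l + 2 \<le> h" | "h < l" by linarith
      then show ?thesis
      proof cases
        case 1
        then show ?thesis using el borel_min_le_diagonal[of t v A] t0 v0 te A unfolding K by simp
      next
        case 2
        then show ?thesis using el eh up(2) theta_here_mono[of t A b v] t0 te b ve by (simp add: K)
      next
        case 3
        then show ?thesis using el eh up(1) theta_pred_mono[of v B a t] v0 ve a te by (simp add: K)
      qed
    qed
  qed
qed

section \<open>Realising prescribed futures and pasts\<close>

lemma ones_prefix_tendsto: "(ones_prefix l \<longlongrightarrow> ones l) (at_right 0)"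
proof (induction l)
  case 0
  have "ones_prefix 0 = (\<lambda>s. s)" by (simp add: fun_eq_iff)
  then show ?case by (simp add: tendsto_ident_at)
next
  case (Suc l)
  have step: "ones_prefix (Suc l) = (\<lambda>s. 1 / (1 + ones_prefix l s))"
    by (simp add: fun_eq_iff ones_prefix_Suc)
  have "1 + ones l \<noteq> 0" using ones_nonneg[of l] by linarith
  then show ?case unfolding ones_Suc step
    by (intro tendsto_divide tendsto_add tendsto_const Suc)
qed

lemma cf_digit_of_cf_digits:
  assumes "cf_digits x n = ds" "1 \<le> i" "i \<le> n"
  shows "cf_digit x i = ds ! (i - 1)"
  using assms by (auto simp: cf_digits_def simp del: upt_Suc)

text \<open>Both possible corner values of \<open>v\<close> are attained: \<open>ones h\<close> by a past of \<open>h\<close> ones and nothing else,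
\<open>ones (h + 2)\<close> by the same past preceded by a digit \<open>2\<close>. The future can be prescribed
independently.\<close>

lemma borel_case_attained:
  assumes l: "1 \<le> l" and h: "1 \<le> h" and s: "0 < s" "s \<le> 1 / 2" and v: "v = ones (h + 2) \<or> v = ones h"
  obtains x n where "borel_case x n l h" "cf_t x n = ones_prefix l s" "cf_v x n = v"
proof -
  define es where "es = (if v = ones h then [] else [2 :: nat])"
  define ds where "ds = es @ replicate h 1"
  define n where "n = length ds"
  define y where "y = ones_prefix l s"
  define x where "x = cf_prepend ds y"
  have y: "0 < y" "y < 1" and y_tail: "cf_t y l = s" and y_digits: "cf_digits y l = replicate l 1"
    using cf_prepend_expansion[of "replicate l 1" s] s by (auto simp: y_def ones_prefix_def)
  have ds: "\<forall>d\<in>set ds. 1 \<le> d" by (auto simp: ds_def es_def)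
  have x: "0 < x" "x < 1" and t: "cf_t x n = y" and digits: "cf_digits x n = ds"
    using cf_prepend_expansion[OF ds y] by (auto simp: x_def n_def)
  have n: "h \<le> n" "1 \<le> n" "n - h = length es" using h by (auto simp: n_def ds_def)
  have last: "cf_digit x n = 1"
  proof -
    have "n - 1 = length es + (h - 1)" using h by (simp add: n_def ds_def)
    then have "ds ! (n - 1) = replicate h 1 ! (h - 1)" by (simp only: ds_def nth_append_length_plus)
    then have "ds ! (n - 1) = 1" using h by simp
    then show ?thesis using cf_digit_of_cf_digits[OF digits, of n] n by simp
  qed
  have nz: "\<forall>i<n. cf_t x i \<noteq> 0"
  proof -
    have "cf_t x (n - 1) \<noteq> 0" using last n(2) cf_t_nonzero_of_cf_digit[of x "n - 1"] by simp
    then show ?thesis using cf_t_nonzero_antimono by (metis Suc_diff_1 less_Suc_eq_le n(2) less_eq_Suc_le One_nat_def)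
  qed
  have rev_ds: "rev ds = replicate h 1 @ rev es" by (simp add: ds_def)
  have v_eq: "cf_v x n = cf_value (replicate h 1 @ rev es)"
    using cf_v_eq_cf_value[of x n] x nz digits by (simp add: rev_ds)
  also have "\<dots> = ones_prefix h (cf_value (rev es))" by (simp only: cf_value_append ones_prefix_def)
  also have "\<dots> = v"
    using v ones_add_2[of h] by (auto simp: es_def ones_def)
  finally have v_val: "cf_v x n = v" .
  have prefix: "cf_digits x (n - h) = es"
  proof -
    have "cf_digits x (n - h) = take (n - h) (cf_digits x n)"
      using n(1) by (simp add: cf_digits_def take_map take_upt del: upt_Suc)
    then show ?thesis by (simp add: digits n ds_def)
  qed
  have past: "past_ones x n h"
    unfolding past_ones_def
  proof (intro conjI impI)
    assume "h < n"
    then have "es = [2]" using n by (auto simp: es_def split: if_splits)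
    then show "cf_digit x (n - h) \<noteq> 1"
      using cf_digit_of_cf_digits[OF prefix, of 1] n by simp
  qed (use h n v_eq prefix in auto)
  have "2 \<le> 1 / s" using s by (simp add: field_simps)
  then have "2 \<le> \<lfloor>1 / s\<rfloor>" by (simp add: le_floor_iff)
  then have "nat \<lfloor>1 / s\<rfloor> \<noteq> 1" by linarith
  then have tail_digit: "cf_digit x (n + l + 1) \<noteq> 1"
    using cf_t_add[of x n l] by (simp add: cf_digit_def t y_tail)
  have future: "future_ones x n l"
    unfolding future_ones_def using l tail_digit by (simp add: t y_digits)
  have "cf_digit x (n + 1) = cf_digit y 1" using cf_digit_shift[of 1 x n] by (simp add: t)
  also have "\<dots> = 1" using cf_digit_of_cf_digits[OF y_digits, of 1] l by simp
  finally have first: "cf_digit x (n + 1) = 1" .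
  have "y \<noteq> golden"
  proof
    assume "y = golden"
    then have "ones_prefix l s = ones_prefix l golden" by (simp add: y_def ones_prefix_golden)
    then show False
      using ones_prefix_strict_mono[of s golden l] s golden_bounds by (auto split: if_splits)
  qed
  then have "borel_case x n l h"
    using x n last first future past by (simp add: borel_case_def t)
  then show thesis using that t v_val by (simp add: y_def)
qed

section \<open>The upper bound and its optimality\<close>

lemma min_theta_eq_borel_min:
  assumes "0 \<le> x" "x < 1" "\<forall>i<n. cf_t x i \<noteq> 0" "1 \<le> n" "cf_digit x (n + 1) = 1"
  shows "min_theta x n = borel_min (cf_t x n) (cf_v x n)"
proof -
  have "0 \<le> cf_t x n" "0 \<le> cf_v x n" using cf_t_range cf_v_range assms by auto
  then show ?thesis
    using theta_eqs[OF assms] by (simp add: min_theta_def borel_min_eq min.commute min.left_commute)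
qed

lemma cf_t_nonzero_of_cf_digit_pos:
  assumes "1 \<le> n" "cf_digit x n \<noteq> 0"
  shows "\<forall>i<n. cf_t x i \<noteq> 0"
proof -
  have "cf_t x (n - 1) \<noteq> 0" using assms cf_t_nonzero_of_cf_digit[of x "n - 1"] by simp
  then show ?thesis using cf_t_nonzero_antimono[of x "n - 1"] by auto
qed

lemma min_theta_borel_case:
  assumes "borel_case x n l h"
  shows "min_theta x n = borel_min (cf_t x n) (cf_v x n)"
  using assms cf_t_nonzero_of_cf_digit_pos[of n x]
  by (intro min_theta_eq_borel_min) (auto simp: borel_case_def)

lemma min_theta_le_borel_const:
  assumes "1 \<le> l" "1 \<le> h" "borel_case x n l h"
  shows "min_theta x n \<le> borel_const l h"
proof -
  have x: "0 \<le> x" "x < 1" and nz: "\<forall>i<n. cf_t x i \<noteq> 0"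
    and fut: "future_ones x n l" and past: "past_ones x n h"
    using assms(3) cf_t_nonzero_of_cf_digit_pos[of n x] by (auto simp: borel_case_def)
  obtain s where s: "0 < s" "s \<le> 1 / 2" "cf_t x n = ones_prefix l s" using future_ones_tail[OF x fut] .
  obtain r where r: "0 \<le> r" "r \<le> 1 / 2" "cf_v x n = ones_prefix h r" using past_ones_tail[OF x nz past] .
  show ?thesis unfolding min_theta_borel_case[OF assms(3)]
    using borel_min_le_borel_const[OF assms(1,2), of "cf_t x n" "cf_v x n"] cf_t_range(2)[OF x, of n]
      ones_prefix_bounds[of s l] ones_prefix_bounds[of r h] s r by force
qed

text \<open>A corner with \<open>t = ones (l + 2)\<close> is attained, by the tail \<open>1 / 2\<close>. A corner with \<open>t = ones l\<close> is
not, since futures have positive tails, but it is the limit of attained points as the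
tail tends to \<open>0\<close>.\<close>

lemma borel_const_optimal:
  assumes l: "1 \<le> l" and h: "1 \<le> h" and C: "\<forall>x n. borel_case x n l h \<longrightarrow> min_theta x n \<le> C"
  shows "borel_const l h \<le> C"
proof -
  obtain t v where tv: "t = ones (l + 2) \<or> t = ones l" "v = ones (h + 2) \<or> v = ones h"
    and K: "borel_const l h = borel_min t v"
    using borel_const_corner[OF l h] .
  have bound: "borel_min (ones_prefix l s) v \<le> C" if s: "0 < s" "s \<le> 1 / 2" for s
  proof -
    obtain x n where "borel_case x n l h" "cf_t x n = ones_prefix l s" "cf_v x n = v"
      using borel_case_attained[OF l h s tv(2)] .
    then show ?thesis using C min_theta_borel_case by metis
  qed
  have v: "0 \<le> v" using tv(2) ones_nonneg by auto
  show ?thesis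
  proof (cases "t = ones (l + 2)")
    case True
    then show ?thesis using bound[of "1 / 2"] K by (simp only: ones_add_2)
  next
    case False
    then have t: "t = ones l" using tv(1) by simp
    have "1 + ones l * v \<noteq> 0" using v ones_nonneg[of l] by (metis add_pos_nonneg less_irrefl mult_nonneg_nonneg zero_less_one)
    then have "((\<lambda>s. borel_min (ones_prefix l s) v) \<longlongrightarrow> borel_min t v) (at_right 0)"
      unfolding borel_min_def t
      by (intro tendsto_divide tendsto_min tendsto_mult tendsto_add tendsto_diff tendsto_const ones_prefix_tendsto)
    moreover have "\<forall>\<^sub>F s in at_right 0. borel_min (ones_prefix l s) v \<le> C"
      unfolding eventually_at_right_field using bound by (intro exI[of _ "1 / 2"]) auto
    ultimately show ?thesis unfolding K by (rule tendsto_upperbound) simp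
  qed
qed

section \<open>Golden futures\<close>

lemma golden_future:
  assumes x: "0 \<le> x" "x < 1" and t: "cf_t x n = golden"
  shows "\<forall>i\<le>n. cf_t x i \<noteq> 0" "cf_digit x (n + 1) = 1" "cf_t x (Suc n) = golden"
proof -
  have "cf_t x n \<noteq> 0" using t golden_bounds by simp
  then show "\<forall>i\<le>n. cf_t x i \<noteq> 0" using cf_t_nonzero_antimono by blast
  have inv: "1 / golden = 1 + golden" using golden_fixpoint golden_bounds by (simp add: field_simps)
  have fl: "\<lfloor>1 / golden\<rfloor> = 1" using golden_bounds by (simp add: inv floor_eq_iff)
  show "cf_digit x (n + 1) = 1" by (simp add: cf_digit_def t fl)
  show "cf_t x (Suc n) = golden" using golden_bounds by (simp add: cf_t_Suc t gauss_map_def fl) (simp add: inv)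
qed

lemma theta_succ_golden_strict_mono:
  assumes "0 \<le> u" "u < v"
  shows "theta_succ golden u < theta_succ golden v"
proof -
  have p: "0 < 1 + golden * u" "0 < 1 + golden * v" using assms golden_bounds by (simp_all add: add_pos_nonneg)
  have "(1 + v) * (1 + golden * u) - (1 + u) * (1 + golden * v) = (1 - golden) * (v - u)" by algebra
  also have "\<dots> > 0" using assms golden_bounds by simp
  finally have "(1 + u) / (1 + golden * u) < (1 + v) / (1 + golden * v)"
    using p by (simp add: frac_less_eq divide_less_0_iff mult.commute)
  then have "(1 - golden) * ((1 + u) / (1 + golden * u)) < (1 - golden) * ((1 + v) / (1 + golden * v))"
    using golden_bounds by (intro mult_strict_left_mono) auto
  then show ?thesis by (simp add: theta_succ_def)
qed

lemma theta_golden_golden: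
  shows "theta_here golden golden = 1 / sqrt 5" "theta_succ golden golden = 1 / sqrt 5"
proof -
  show "theta_here golden golden = 1 / sqrt 5"
    by (simp add: theta_here_def golden_over_one_plus_square)
  have "(1 - golden) * (1 + golden) = golden" using golden_square by algebra
  then show "theta_succ golden golden = 1 / sqrt 5"
    by (simp add: theta_succ_def golden_over_one_plus_square)
qed

lemma theta_here_golden_strict_antimono:
  assumes "0 \<le> u" "u < v"
  shows "theta_here golden v < theta_here golden u"
  unfolding theta_here_def using assms golden_bounds
  by (intro divide_strict_left_mono mult_pos_pos) (auto intro: add_pos_nonneg)

text \<open>The numerators differ by \<open>golden (golden - v)\<close>.\<close>

lemma theta_pred_less_theta_succ_golden:
  assumes "0 \<le> v"
  shows "theta_pred golden v < theta_succ golden v \<longleftrightarrow> v < golden"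
    and "theta_succ golden v < theta_pred golden v \<longleftrightarrow> golden < v"
proof -
  have p: "0 < 1 + golden * v" using assms golden_bounds by (simp add: add_pos_nonneg)
  have "(1 - golden) * (1 + v) - v = golden * (golden - v)" using golden_square by algebra
  then have "v < (1 - golden) * (1 + v) \<longleftrightarrow> 0 < golden * (golden - v)"
    "(1 - golden) * (1 + v) < v \<longleftrightarrow> golden * (golden - v) < 0"
    by linarith+
  then show "theta_pred golden v < theta_succ golden v \<longleftrightarrow> v < golden"
    "theta_succ golden v < theta_pred golden v \<longleftrightarrow> golden < v"
    using p golden_bounds
    by (simp_all add: theta_pred_def theta_succ_def divide_less_cancel zero_less_mult_iff mult_less_0_iff)
qed

lemma golden_order_above:
  assumes "golden < v"
  shows "theta_here golden v < 1 / sqrt 5" "1 / sqrt 5 < theta_succ golden v"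
    "theta_succ golden v < theta_pred golden v"
  using assms golden_bounds theta_here_golden_strict_antimono[of golden v]
    theta_succ_golden_strict_mono[of golden v] theta_pred_less_theta_succ_golden[of v]
  by (simp_all add: theta_golden_golden)

lemma golden_order_below:
  assumes "0 \<le> v" "v < golden"
  shows "theta_pred golden v < theta_succ golden v" "theta_succ golden v < 1 / sqrt 5"
    "1 / sqrt 5 < theta_here golden v"
  using assms theta_here_golden_strict_antimono[of v golden]
    theta_succ_golden_strict_mono[of v golden] theta_pred_less_theta_succ_golden[of v]
  by (simp_all add: theta_golden_golden)

lemma theta_golden_future:
  assumes x: "0 \<le> x" "x < 1" and n: "1 \<le> n" and t: "cf_t x n = golden"
  shows "theta x (n - 1) = theta_pred golden (cf_v x n)"
    and "theta x n = theta_here golden (cf_v x n)"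
    and "theta x (n + 1) = theta_succ golden (cf_v x n)"
  using theta_eqs[OF x _ n golden_future(2)[OF x t]] golden_future(1)[OF x t] t by simp_all

lemma golden_future_past_above:
  assumes x: "0 \<le> x" "x < 1" and n: "1 \<le> n" and t: "cf_t x n = golden" and v: "golden < cf_v x n"
  shows "min_theta x n = theta x n" "theta x n < 1 / sqrt 5" "1 / sqrt 5 < theta x (n + 1)"
    "theta x (n + 1) < theta x (n - 1)"
proof -
  show *: "theta x n < 1 / sqrt 5" "1 / sqrt 5 < theta x (n + 1)" "theta x (n + 1) < theta x (n - 1)"
    using golden_order_above[OF v] by (simp_all only: theta_golden_future[OF x n t])
  show "min_theta x n = theta x n"
    unfolding min_theta_def by (rule Min_eqI) (use * in auto)
qed

lemma golden_future_past_below: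
  assumes x: "0 \<le> x" "x < 1" and n: "1 \<le> n" and t: "cf_t x n = golden" and v: "cf_v x n < golden"
  shows "min_theta x n = theta x (n - 1)" "theta x (n - 1) < theta x (n + 1)"
    "theta x (n + 1) < 1 / sqrt 5" "1 / sqrt 5 < theta x n"
proof -
  have "0 \<le> cf_v x n" using cf_v_range(1)[OF x] golden_future(1)[OF x t] by simp
  then show *: "theta x (n - 1) < theta x (n + 1)" "theta x (n + 1) < 1 / sqrt 5" "1 / sqrt 5 < theta x n"
    using golden_order_below[OF _ v] by (simp_all only: theta_golden_future[OF x n t])
  show "min_theta x n = theta x (n - 1)"
    unfolding min_theta_def by (rule Min_eqI) (use * in auto)
qed

text \<open>From \<open>a\<^sub>n \<ge> 2\<close> it follows that \<open>v \<le> 1 / 2\<close>, with equality exactly if \<open>a\<^sub>n = 2\<close> and no digit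
precedes it. Hence \<open>v < golden\<close>, which settles the order of the coefficients; and \<open>v = 1 / 2\<close> gives \<open>\<Theta>\<^sub>n\<^sub>-\<^sub>1 = golden\<^sup>2\<close>. The lower bound for
\<open>\<Theta>\<^sub>n\<^sub>+\<^sub>1\<close> is its value at \<open>v = 0\<close>.\<close>

lemma golden_future_large_digit:
  assumes x: "0 \<le> x" "x < 1" and n: "1 \<le> n" and t: "cf_t x n = golden" and a: "2 \<le> cf_digit x n"
  shows "min_theta x n = theta x (n - 1)"
    and "\<not> (n = 1 \<and> cf_digit x 1 = 2) \<Longrightarrow> theta x (n - 1) < golden\<^sup>2"
    and "n = 1 \<and> cf_digit x 1 = 2 \<Longrightarrow> theta x (n - 1) = golden\<^sup>2"
    and "golden\<^sup>2 < theta x (n + 1)" "theta x (n + 1) < 1 / sqrt 5" "1 / sqrt 5 < theta x n"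
proof -
  define v where "v = cf_v x n"
  obtain m where m: "n = Suc m" using n by (cases n) auto
  have nz: "\<forall>i<n. cf_t x i \<noteq> 0" using golden_future(1)[OF x t] by simp
  have v_eq: "v = 1 / (real (cf_digit x n) + cf_v x m)"
    using cf_v_Suc[OF x, of m] nz by (simp add: v_def m)
  have w: "0 \<le> cf_v x m" using cf_v_range(1)[OF x, of m] nz m by simp
  have w_pos: "0 < cf_v x m" if "m \<noteq> 0"
  proof -
    obtain k where k: "m = Suc k" using \<open>m \<noteq> 0\<close> not0_implies_Suc by blast
    have "cf_v x m = 1 / (real (cf_digit x m) + cf_v x k)" "1 \<le> cf_digit x m" "0 \<le> cf_v x k"
      using cf_v_Suc[OF x, of k] cf_t_step(1)[OF x, of k] cf_v_range(1)[OF x, of k] nz m k by simp_all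
    then show ?thesis by (simp add: add_pos_nonneg)
  qed
  have v0: "0 < v" using v_eq a w by (simp add: add_pos_nonneg)
  have a': "2 \<le> real (cf_digit x n)" using a by simp
  have half: "v \<le> 1 / 2" using v_eq a' w by (simp add: divide_le_eq)
  have strict: "v < 1 / 2" if "\<not> (n = 1 \<and> cf_digit x 1 = 2)"
  proof -
    have "2 < real (cf_digit x n) + cf_v x m"
    proof (cases "m = 0")
      case True
      then have "cf_digit x n \<noteq> 2" using that m by auto
      then have "3 \<le> real (cf_digit x n)" using a by simp
      then show ?thesis using w by linarith
    next
      case False
      then show ?thesis using w_pos a' by linarith
    qed
    then show ?thesis using v_eq by (simp add: divide_less_eq)
  qed
  have eq: "v = 1 / 2" if "n = 1 \<and> cf_digit x 1 = 2"
    using that v_eq m by (simp add: cf_v_def)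
  have "cf_v x n < golden" using half golden_bounds by (simp add: v_def)
  note below = golden_future_past_below[OF x n t this]
  show "min_theta x n = theta x (n - 1)" "theta x (n + 1) < 1 / sqrt 5" "1 / sqrt 5 < theta x n"
    by (fact below)+
  have p: "0 < 1 + golden * v" using v0 golden_bounds by (simp add: add_pos_pos)
  have id: "golden\<^sup>2 * (1 + golden * v) - v = (1 - golden) * (1 - 2 * v)"
    using golden_square by algebra
  have pred: "theta x (n - 1) = v / (1 + golden * v)"
    by (simp only: theta_golden_future[OF x n t] theta_pred_def v_def)
  show "theta x (n - 1) < golden\<^sup>2" if "\<not> (n = 1 \<and> cf_digit x 1 = 2)"
  proof -
    have "0 < (1 - golden) * (1 - 2 * v)" using strict[OF that] golden_bounds by simp
    then show ?thesis unfolding pred using id p by (simp add: divide_less_eq)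
  qed
  show "theta x (n - 1) = golden\<^sup>2" if "n = 1 \<and> cf_digit x 1 = 2"
  proof -
    have "golden\<^sup>2 * (1 + golden * v) = v" using id unfolding eq[OF that] by simp
    then show ?thesis unfolding pred using p by (simp add: divide_eq_eq)
  qed
  show "golden\<^sup>2 < theta x (n + 1)"
  proof -
    have "theta_succ golden 0 = golden\<^sup>2" by (simp add: theta_succ_def power2_eq_square golden_square)
    then show ?thesis
      using theta_succ_golden_strict_mono[of 0 v] v0 by (simp only: theta_golden_future[OF x n t] v_def)
  qed
qed

text \<open>The two one-sided bounds for an even block of ones meet in this common value, so the strict
inequality between \<open>\<Theta>\<^sub>n\<^sub>-\<^sub>1\<close> and \<open>\<Theta>\<^sub>n\<^sub>+\<^sub>1\<close> has to come from \<open>v > ones l\<close>.\<close>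

lemma theta_succ_golden_ones: "theta_succ golden (ones l) = theta_pred golden (ones (l + 2))"
proof -
  define u where "u = ones l"
  have "0 \<le> u" by (simp add: u_def ones_nonneg)
  have p: "0 < 2 + u" "0 < 1 + golden * u" "0 < 2 + golden"
    using \<open>0 \<le> u\<close> golden_bounds by (simp_all add: add_pos_nonneg)
  have c: "ones (l + 2) = (1 + u) / (2 + u)"
    using here_eq_succ_at_ones[of l] p(1) by (simp add: u_def field_simps)
  have q: "2 + u + golden * (1 + u) = (2 + golden) * (1 + golden * u)" using golden_square by algebra
  have "1 + golden * ((1 + u) / (2 + u)) = (2 + u + golden * (1 + u)) / (2 + u)"
    using p(1) by (simp add: field_simps)
  then have "theta_pred golden (ones (l + 2)) = (1 + u) / (2 + u + golden * (1 + u))"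
    unfolding c theta_pred_def using p(1) by simp
  also have "\<dots> = (1 / (2 + golden)) * ((1 + u) / (1 + golden * u))" by (simp add: q)
  also have "1 / (2 + golden) = 1 - golden"
  proof -
    have "(1 - golden) * (2 + golden) = 1" using golden_square by algebra
    then show ?thesis using p(3) by (simp add: divide_eq_eq)
  qed
  finally show ?thesis by (simp add: theta_succ_def u_def)
qed

text \<open>Since \<open>l < n\<close>, a digit precedes the block, so the tail \<open>s\<close> of the past is positive. For even
\<open>l\<close> this is what makes \<open>cf_v x n\<close> exceed \<open>ones l\<close> strictly.\<close>

lemma golden_future_past_ones:
  assumes x: "0 \<le> x" "x < 1" and n: "1 \<le> n" and t: "cf_t x n = golden"
    and l: "l < n" and past: "past_ones x n l"
  defines "c \<equiv> cf_c (int l)"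
  shows "odd l \<Longrightarrow> min_theta x n = theta x n \<and> theta x n \<le> golden / (1 + golden * c) \<and>
      golden / (1 + golden * c) < 1 / sqrt 5 \<and> 1 / sqrt 5 < theta x (n + 1) \<and>
      theta x (n + 1) < theta x (n - 1)"
    and "even l \<Longrightarrow> min_theta x n = theta x (n - 1) \<and> theta x (n - 1) \<le> c / (1 + golden * c) \<and>
      c / (1 + golden * c) < theta x (n + 1) \<and> theta x (n + 1) < 1 / sqrt 5 \<and> 1 / sqrt 5 < theta x n"
proof -
  have nz: "\<forall>i<n. cf_t x i \<noteq> 0" using golden_future(1)[OF x t] by simp
  obtain s where s: "0 \<le> s" "s \<le> 1 / 2" "0 < s" "cf_v x n = ones_prefix l s"
    using past_ones_tail[OF x nz past] l by metis
  have c: "c = ones (l + 2)" unfolding c_def by (rule cf_c_int)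
  have c_here: "golden / (1 + golden * c) = theta_here golden c" by (simp add: theta_here_def)
  have c_pred: "c / (1 + golden * c) = theta_pred golden c" by (simp add: theta_pred_def)
  {
    assume odd: "odd l"
    have cg: "golden < c" using odd golden_less_ones[of "l + 2"] by (simp add: c)
    have cv: "c \<le> cf_v x n" using ones_prefix_bounds(2)[OF s(1,2) odd] by (simp add: c s(4))
    have "golden < cf_v x n" using cg cv by simp
    note above = golden_future_past_above[OF x n t this]
    have "theta x n \<le> theta_here golden c"
      using theta_here_mono[of golden golden c "cf_v x n"] cv cg golden_bounds
      by (simp add: theta_golden_future[OF x n t])
    then show "min_theta x n = theta x n \<and> theta x n \<le> golden / (1 + golden * c) \<and>
      golden / (1 + golden * c) < 1 / sqrt 5 \<and> 1 / sqrt 5 < theta x (n + 1) \<and>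
      theta x (n + 1) < theta x (n - 1)"
      using above golden_order_above(1)[OF cg] unfolding c_here by blast
  next
    assume even: "even l"
    have cg: "c < golden" using even ones_less_golden[of "l + 2"] by (simp add: c)
    have cv: "cf_v x n \<le> c" using ones_prefix_bounds(1)[OF s(1,2) even] by (simp add: c s(4))
    have "cf_v x n < golden" using cg cv by simp
    note below = golden_future_past_below[OF x n t this]
    have v0: "0 \<le> cf_v x n" using s by (simp add: ones_prefix_nonneg)
    have "theta x (n - 1) \<le> theta_pred golden c"
      using theta_pred_mono[of "cf_v x n" c golden golden] cv v0 golden_bounds
      by (simp only: theta_golden_future[OF x n t])
    moreover have "theta_pred golden c < theta x (n + 1)"
    proof -
      have "ones l < cf_v x n"
        using ones_prefix_strict_mono[of 0 s l] s even by (simp add: ones_def)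
      then show ?thesis
        using theta_succ_golden_strict_mono[of "ones l" "cf_v x n"] ones_nonneg[of l]
        by (simp only: theta_golden_future[OF x n t] c theta_succ_golden_ones)
    qed
    ultimately show "min_theta x n = theta x (n - 1) \<and> theta x (n - 1) \<le> c / (1 + golden * c) \<and>
      c / (1 + golden * c) < theta x (n + 1) \<and> theta x (n + 1) < 1 / sqrt 5 \<and> 1 / sqrt 5 < theta x n"
      using below unfolding c_pred by blast
  }
qed

lemma golden_expansion:
  shows "cf_t golden m = golden" "cf_digit golden (Suc m) = 1" "cf_digits golden m = replicate m 1"
    "cf_v golden m = ones m"
proof -
  have g: "0 \<le> golden" "golden < 1" using golden_bounds by auto
  show t: "cf_t golden m = golden" for m
    by (induction m) (use golden_future(3)[OF g] in auto)
  show digit: "cf_digit golden (Suc m) = 1" for m using golden_future(2)[OF g t] by simp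
  show digits: "cf_digits golden m = replicate m 1" for m
    by (induction m) (simp_all add: cf_digits_Suc digit replicate_append_same)
  show "cf_v golden m = ones m"
    using cf_v_eq_cf_value[OF g, of m] golden_bounds by (simp add: t digits cf_value_replicate_1[symmetric])
qed

lemma golden_orbit:
  assumes m: "1 \<le> m"
  shows "odd m \<Longrightarrow> min_theta golden m = theta golden m \<and>
      theta golden m = golden / (1 + golden * cf_c (int m - 2)) \<and>
      golden / (1 + golden * cf_c (int m - 2)) < 1 / sqrt 5 \<and>
      1 / sqrt 5 < theta golden (m + 1) \<and> theta golden (m + 1) < theta golden (m - 1)"
    and "even m \<Longrightarrow> min_theta golden m = theta golden (m - 1) \<and>
      theta golden (m - 1) = golden / (1 + golden * cf_c (int m - 3)) \<and>
      golden / (1 + golden * cf_c (int m - 3)) < theta golden (m + 1) \<and>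
      theta golden (m + 1) < 1 / sqrt 5 \<and> 1 / sqrt 5 < theta golden m"
proof -
  have g: "0 \<le> golden" "golden < 1" using golden_bounds by auto
  have here: "theta golden k = golden / (1 + golden * ones k)" for k
    using theta_eq[OF g, of k] golden_bounds by (simp add: golden_expansion)
  {
    assume "odd m"
    then have "golden < cf_v golden m" by (simp add: golden_expansion golden_less_ones)
    from golden_future_past_above[OF g m golden_expansion(1) this]
    show "min_theta golden m = theta golden m \<and>
      theta golden m = golden / (1 + golden * cf_c (int m - 2)) \<and>
      golden / (1 + golden * cf_c (int m - 2)) < 1 / sqrt 5 \<and>
      1 / sqrt 5 < theta golden (m + 1) \<and> theta golden (m + 1) < theta golden (m - 1)"
      unfolding cf_c_int_minus_2[OF m] here[of m, symmetric] by blast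
  next
    assume even: "even m"
    then have "cf_v golden m < golden" by (simp add: golden_expansion ones_less_golden)
    note below = golden_future_past_below[OF g m golden_expansion(1) this]
    have "2 \<le> m" using m even by presburger
    then have "nat (int m - 3 + 2) = m - 1" by linarith
    then have "cf_c (int m - 3) = ones (m - 1)" using cf_c_eq_ones[of "int m - 3"] \<open>2 \<le> m\<close> by simp
    then have eq: "golden / (1 + golden * cf_c (int m - 3)) = theta golden (m - 1)"
      by (simp only: here)
    show "min_theta golden m = theta golden (m - 1) \<and>
      theta golden (m - 1) = golden / (1 + golden * cf_c (int m - 3)) \<and>
      golden / (1 + golden * cf_c (int m - 3)) < theta golden (m + 1) \<and>
      theta golden (m + 1) < 1 / sqrt 5 \<and> 1 / sqrt 5 < theta golden m"
      using below unfolding eq by blast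
  }
qed

theorem theorem3p1:
  shows
    \<comment> \<open>the two expansions of \<open>t_n\<close> and \<open>v_n\<close>\<close>
    "(\<forall>x n. 0 \<le> x \<and> x < 1 \<and> 1 \<le> n \<and> cf_digit x n \<noteq> 0 \<longrightarrow>
        (\<forall>i\<ge>1. cf_digit (cf_t x n) i = cf_digit x (n + i)) \<and>
        cf_v x n = cf_value (rev (cf_digits x n)))
     \<and>
     \<comment> \<open>(i)\<close>
     (\<forall>l h. 1 \<le> l \<and> 1 \<le> h \<longrightarrow>
        (\<forall>x n. borel_case x n l h \<longrightarrow> min_theta x n \<le> borel_const l h) \<and>
        borel_const l h < 1 / sqrt 5 \<and>
        \<not> (\<exists>C < borel_const l h. \<forall>x n. borel_case x n l h \<longrightarrow> min_theta x n \<le> C))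
     \<and>
     \<comment> \<open>(iia); equality with \<open>g^2\<close> occurs exactly for \<open>n = 1\<close>, \<open>a_1 = 2\<close>\<close>
     (\<forall>x n. 0 \<le> x \<and> x < 1 \<and> 1 \<le> n \<and> cf_t x n = golden \<and> cf_digit x n \<ge> 2 \<longrightarrow>
        min_theta x n = theta x (n - 1) \<and>
        (\<not> (n = 1 \<and> cf_digit x 1 = 2) \<longrightarrow> theta x (n - 1) < golden\<^sup>2) \<and>
        (n = 1 \<and> cf_digit x 1 = 2 \<longrightarrow> theta x (n - 1) = golden\<^sup>2) \<and>
        golden\<^sup>2 < theta x (n + 1) \<and>
        theta x (n + 1) < 1 / sqrt 5 \<and>
        1 / sqrt 5 < theta x n)
     \<and>
     \<comment> \<open>(iib)\<close>
     (\<forall>x n l. 0 \<le> x \<and> x < 1 \<and> 1 \<le> n \<and> cf_t x n = golden \<and> l < n \<and> past_ones x n l \<longrightarrow>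
        (odd l \<longrightarrow>
           min_theta x n = theta x n \<and>
           theta x n \<le> golden / (1 + golden * cf_c (int l)) \<and>
           golden / (1 + golden * cf_c (int l)) < 1 / sqrt 5 \<and>
           1 / sqrt 5 < theta x (n + 1) \<and>
           theta x (n + 1) < theta x (n - 1)) \<and>
        (even l \<longrightarrow>
           min_theta x n = theta x (n - 1) \<and>
           theta x (n - 1) \<le> cf_c (int l) / (1 + golden * cf_c (int l)) \<and>
           cf_c (int l) / (1 + golden * cf_c (int l)) < theta x (n + 1) \<and>
           theta x (n + 1) < 1 / sqrt 5 \<and>
           1 / sqrt 5 < theta x n))
     \<and>
     \<comment> \<open>(iic)\<close>
     (\<forall>x. 0 \<le> x \<and> x < 1 \<and> cf_t x 0 = golden \<longrightarrow>
        x = golden \<and> (\<forall>i\<ge>1. cf_digit x i = 1) \<and> cf_v x 0 = 0 \<and>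
        (\<forall>m\<ge>1.
           cf_t x m = golden \<and>
           cf_v x m = cf_value (replicate m 1) \<and>
           (odd m \<longrightarrow>
              min_theta x m = theta x m \<and>
              theta x m = golden / (1 + golden * cf_c (int m - 2)) \<and>
              golden / (1 + golden * cf_c (int m - 2)) < 1 / sqrt 5 \<and>
              1 / sqrt 5 < theta x (m + 1) \<and>
              theta x (m + 1) < theta x (m - 1)) \<and>
           (even m \<longrightarrow>
              min_theta x m = theta x (m - 1) \<and>
              theta x (m - 1) = golden / (1 + golden * cf_c (int m - 3)) \<and>
              golden / (1 + golden * cf_c (int m - 3)) < theta x (m + 1) \<and>
              theta x (m + 1) < 1 / sqrt 5 \<and>
              1 / sqrt 5 < theta x m)))"
proof (intro conjI)
  show "\<forall>x n. 0 \<le> x \<and> x < 1 \<and> 1 \<le> n \<and> cf_digit x n \<noteq> 0 \<longrightarrow>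
        (\<forall>i\<ge>1. cf_digit (cf_t x n) i = cf_digit x (n + i)) \<and>
        cf_v x n = cf_value (rev (cf_digits x n))"
    using cf_digit_shift cf_v_eq_cf_value cf_t_nonzero_of_cf_digit_pos by blast
next
  show "\<forall>l h. 1 \<le> l \<and> 1 \<le> h \<longrightarrow>
        (\<forall>x n. borel_case x n l h \<longrightarrow> min_theta x n \<le> borel_const l h) \<and>
        borel_const l h < 1 / sqrt 5 \<and>
        \<not> (\<exists>C < borel_const l h. \<forall>x n. borel_case x n l h \<longrightarrow> min_theta x n \<le> C)"
    by (meson min_theta_le_borel_const borel_const_less borel_const_optimal not_less)
next
  show "\<forall>x n. 0 \<le> x \<and> x < 1 \<and> 1 \<le> n \<and> cf_t x n = golden \<and> cf_digit x n \<ge> 2 \<longrightarrow>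
        min_theta x n = theta x (n - 1) \<and>
        (\<not> (n = 1 \<and> cf_digit x 1 = 2) \<longrightarrow> theta x (n - 1) < golden\<^sup>2) \<and>
        (n = 1 \<and> cf_digit x 1 = 2 \<longrightarrow> theta x (n - 1) = golden\<^sup>2) \<and>
        golden\<^sup>2 < theta x (n + 1) \<and>
        theta x (n + 1) < 1 / sqrt 5 \<and>
        1 / sqrt 5 < theta x n"
    using golden_future_large_digit by blast
next
  show "\<forall>x n l. 0 \<le> x \<and> x < 1 \<and> 1 \<le> n \<and> cf_t x n = golden \<and> l < n \<and> past_ones x n l \<longrightarrow>
        (odd l \<longrightarrow>
           min_theta x n = theta x n \<and>
           theta x n \<le> golden / (1 + golden * cf_c (int l)) \<and>
           golden / (1 + golden * cf_c (int l)) < 1 / sqrt 5 \<and>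
           1 / sqrt 5 < theta x (n + 1) \<and>
           theta x (n + 1) < theta x (n - 1)) \<and>
        (even l \<longrightarrow>
           min_theta x n = theta x (n - 1) \<and>
           theta x (n - 1) \<le> cf_c (int l) / (1 + golden * cf_c (int l)) \<and>
           cf_c (int l) / (1 + golden * cf_c (int l)) < theta x (n + 1) \<and>
           theta x (n + 1) < 1 / sqrt 5 \<and>
           1 / sqrt 5 < theta x n)"
    using golden_future_past_ones by blast
next
  show "\<forall>x. 0 \<le> x \<and> x < 1 \<and> cf_t x 0 = golden \<longrightarrow>
        x = golden \<and> (\<forall>i\<ge>1. cf_digit x i = 1) \<and> cf_v x 0 = 0 \<and>
        (\<forall>m\<ge>1.
           cf_t x m = golden \<and>
           cf_v x m = cf_value (replicate m 1) \<and>
           (odd m \<longrightarrow>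
              min_theta x m = theta x m \<and>
              theta x m = golden / (1 + golden * cf_c (int m - 2)) \<and>
              golden / (1 + golden * cf_c (int m - 2)) < 1 / sqrt 5 \<and>
              1 / sqrt 5 < theta x (m + 1) \<and>
              theta x (m + 1) < theta x (m - 1)) \<and>
           (even m \<longrightarrow>
              min_theta x m = theta x (m - 1) \<and>
              theta x (m - 1) = golden / (1 + golden * cf_c (int m - 3)) \<and>
              golden / (1 + golden * cf_c (int m - 3)) < theta x (m + 1) \<and>
              theta x (m + 1) < 1 / sqrt 5 \<and>
              1 / sqrt 5 < theta x m))"
  proof (intro allI impI, elim conjE)
    fix x
    assume "cf_t x 0 = golden"
    then have x: "x = golden" by simp
    have digit: "cf_digit golden i = 1" if "1 \<le> i" for i
      using golden_expansion(2)[of "i - 1"] that by simp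
    have past: "cf_v golden m = cf_value (replicate m 1)" for m
      by (simp only: golden_expansion cf_value_replicate_1)
    have zero: "cf_v golden 0 = 0" by (simp add: cf_v_def)
    show "x = golden \<and> (\<forall>i\<ge>1. cf_digit x i = 1) \<and> cf_v x 0 = 0 \<and>
        (\<forall>m\<ge>1.
           cf_t x m = golden \<and>
           cf_v x m = cf_value (replicate m 1) \<and>
           (odd m \<longrightarrow>
              min_theta x m = theta x m \<and>
              theta x m = golden / (1 + golden * cf_c (int m - 2)) \<and>
              golden / (1 + golden * cf_c (int m - 2)) < 1 / sqrt 5 \<and>
              1 / sqrt 5 < theta x (m + 1) \<and>
              theta x (m + 1) < theta x (m - 1)) \<and>
           (even m \<longrightarrow>
              min_theta x m = theta x (m - 1) \<and>
              theta x (m - 1) = golden / (1 + golden * cf_c (int m - 3)) \<and>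
              golden / (1 + golden * cf_c (int m - 3)) < theta x (m + 1) \<and>
              theta x (m + 1) < 1 / sqrt 5 \<and>
              1 / sqrt 5 < theta x m))"
      unfolding x using digit zero golden_expansion(1) past golden_orbit by blast
  qed
qed

end
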